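(* Let $n\ge6$ be an integer, let $\varphi\in\left(\frac{\pi}{4},\frac{\pi}{2}\right)$ be the angle with $\cos\varphi=\dfrac{2n-11}{2n-5}\cdot\dfrac{\sqrt{2n-3}}{\sqrt{5(n-3)}}$, let $$ t_1=-\frac{n-3}{2(2n-1)}-\frac{\sqrt{5(n-3)}}{(2n-1)\sqrt{2n-3}}\cos\left(\frac{\varphi}{3}-\frac{\pi}{3}\right), $$ and let $$ \begin{aligned} f_{n,5}(t)=-t^{2n-11}\Bigl[&16(2n-1)(2n-3)^2(2n-5)^2(2n-11)t^5+80(n-1)(n-3)(2n-3)(2n-5)^2(2n-11)t^4\\ &+40(n-2)(n-3)(2n-3)(2n-5)(2n-7)(2n-11)t^3+40(n-2)(n-3)^2(n-4)(2n-5)(2n-11)t^2\\ &+5(n-3)^2(n-4)^2(2n-5)(2n-11)t+(n-3)^2(n-4)^2(n-5)^2\Bigr]. \end{aligned} $$ Then $$ \Lambda^2_{n,5}=\frac{f_{n,5}(t_1)}{((n-3)!)^2(2n-11)}. $$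
   Context: For integers $n\ge1$, $0\le k\le n-1$ and $a\in[0;1]$, $A_{n,k}(a):=\sup\{|f^{(k)}(a)| : f\in \mathring{W}_2^n[0;1],\ \int_0^1|f^{(n)}(x)|^2dx\le 1\}$, and the sharp embedding constant is $\Lambda_{n,k}:=\sup_{a\in[0;1]}A_{n,k}(a)$, $\Lambda^2_{n,k}=(\Lambda_{n,k})^2$. Here $\mathring{W}_2^n[0;1]$ is the space of functions $f$ on $[0;1]$ whose derivatives up to order $n-1$ are absolutely continuous, with $f^{(n)}\in L_2[0;1]$ and $f^{(j)}(0)=f^{(j)}(1)=0$ for $j=0,\dots,n-1$. *)

theory Defs
  imports "HOL-Analysis.Analysis"
begin

text \<open>Absolute continuity of a function on a compact interval, which the library does not
  provide (its constant of that name is about measures).\<close>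

definition abs_cont_on :: "real \<Rightarrow> real \<Rightarrow> (real \<Rightarrow> real) \<Rightarrow> bool" where
  "abs_cont_on a b g \<longleftrightarrow>
     (\<forall>\<epsilon>>0. \<exists>\<delta>>0. \<forall>(m::nat) u v.
        (\<forall>i<m. a \<le> u i \<and> u i \<le> v i \<and> v i \<le> b) \<and>
        (\<forall>i<m. \<forall>j<m. i \<noteq> j \<longrightarrow> {u i<..<v i} \<inter> {u j<..<v j} = {}) \<and>
        (\<Sum>i<m. v i - u i) < \<delta>
        \<longrightarrow> (\<Sum>i<m. \<bar>g (v i) - g (u i)\<bar>) < \<epsilon>)"

text \<open>Functions on the unit interval are represented by functions \<^typ>\<open>real \<Rightarrow> real\<close> of which only
  the restriction to \<open>{0..1}\<close> matters; accordingly derivatives are taken within \<open>{0..1}\<close> and are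
  one-sided at the endpoints. Where the derivative does not exist the value is unspecified.\<close>

definition deriv01 :: "nat \<Rightarrow> (real \<Rightarrow> real) \<Rightarrow> real \<Rightarrow> real" where
  "deriv01 j f = ((\<lambda>g x. vector_derivative g (at x within {0..1})) ^^ j) f"

text \<open>The space with vanishing boundary values, for \<open>n \<ge> 1\<close>. The derivatives of order below \<open>n\<close>
  exist everywhere, the one of order \<open>n\<close> only almost everywhere. Its existence almost everywhere
  already follows from absolute continuity of the derivative of order \<open>n - 1\<close> (Lebesgue); it is
  listed because \<open>deriv01 n f\<close> is meaningful only under it.\<close>

definition W0 :: "nat \<Rightarrow> (real \<Rightarrow> real) set" where
  "W0 n = {f.
     (\<forall>j. j + 1 < n \<longrightarrow> (\<forall>x\<in>{0..1}. deriv01 j f differentiable (at x within {0..1}))) \<and>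
     (\<forall>j<n. abs_cont_on 0 1 (deriv01 j f)) \<and>
     (AE x in lebesgue_on {0..1}. deriv01 (n - 1) f differentiable (at x within {0..1})) \<and>
     deriv01 n f \<in> borel_measurable (lebesgue_on {0..1}) \<and>
     integrable (lebesgue_on {0..1}) (\<lambda>x. \<bar>deriv01 n f x\<bar>\<^sup>2) \<and>
     (\<forall>j<n. deriv01 j f 0 = 0 \<and> deriv01 j f 1 = 0)}"

text \<open>The suprema are taken in \<^typ>\<open>ereal\<close>, so that they are genuine suprema without a boundedness
  side condition.\<close>

definition A :: "nat \<Rightarrow> nat \<Rightarrow> real \<Rightarrow> ereal" where
  "A n k a = (SUP f \<in> {f \<in> W0 n. (LINT x|lebesgue_on {0..1}. \<bar>deriv01 n f x\<bar>\<^sup>2) \<le> 1}.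
                ereal \<bar>deriv01 k f a\<bar>)"

definition \<Lambda> :: "nat \<Rightarrow> nat \<Rightarrow> ereal" where
  "\<Lambda> n k = (SUP a\<in>{0..1}. A n k a)"

definition f5 :: "nat \<Rightarrow> real \<Rightarrow> real" where
  "f5 n t = (let N = real n in
     - (t ^ (2 * n - 11)) *
     (16 * (2*N - 1) * (2*N - 3)\<^sup>2 * (2*N - 5)\<^sup>2 * (2*N - 11) * t ^ 5
      + 80 * (N - 1) * (N - 3) * (2*N - 3) * (2*N - 5)\<^sup>2 * (2*N - 11) * t ^ 4
      + 40 * (N - 2) * (N - 3) * (2*N - 3) * (2*N - 5) * (2*N - 7) * (2*N - 11) * t ^ 3
      + 40 * (N - 2) * (N - 3)\<^sup>2 * (N - 4) * (2*N - 5) * (2*N - 11) * t\<^sup>2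
      + 5 * (N - 3)\<^sup>2 * (N - 4)\<^sup>2 * (2*N - 5) * (2*N - 11) * t
      + (N - 3)\<^sup>2 * (N - 4)\<^sup>2 * (N - 5)\<^sup>2))"

end

theory Submission
  imports Defs
begin

text \<open>
  For \<open>f\<close> in the space \<open>W0 n\<close>, integration by parts gives \<open>f\<^sup>(\<^sup>k\<^sup>)(a) = \<integral> f\<^sup>(\<^sup>n\<^sup>) K\<close> with the truncated
  power \<open>K(x) = (a - x)\<^sub>+\<^sup>m / m!\<close>, \<open>m = n - k - 1\<close>, while \<open>f\<^sup>(\<^sup>n\<^sup>)\<close> is orthogonal to all polynomials of
  degree below \<open>n\<close>. Hence \<open>A\<^sub>n\<^sub>,\<^sub>k(a)\<close> is the \<open>L\<^sub>2\<close> distance of \<open>K\<close> from these polynomials. Boggio's explicit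
  Green function gives this distance for degree at most \<open>m\<close>; the remaining \<open>k\<close> degrees are removed
  by subtracting projections onto the Legendre polynomials \<open>D\<^sup>j (x\<^sup>2 - x)\<^sup>j\<close>. For \<open>k = 5\<close> this is \<open>f5 n t\<close>, up to
  a constant factor, with \<open>t = a\<^sup>2 - a \<in> [-1/4, 0]\<close>.

  The derivative of \<open>f5\<close> is \<open>t\<^sup>2\<^sup>n\<^sup>-\<^sup>1\<^sup>2\<close> times a cubic \<open>q\<close> times a multiple of \<open>3 q - t q'\<close>. Adding a
  suitable multiple of \<open>-t\<^sup>2\<^sup>n\<^sup>-\<^sup>1\<^sup>1 q\<^sup>2\<close> to \<open>f5\<close> yields a decreasing majorant that touches \<open>f5\<close> at the roots of
  \<open>q\<close> (Sonin's argument), so the smallest root of \<open>q\<close> beats everything to its right. To its left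
  \<open>f5\<close> increases. The roots of \<open>q\<close> are found by trisecting an angle.
\<close>

section \<open>Absolutely continuous functions\<close>

text \<open>The definition numbers its intervals by an initial segment of the naturals, while a
  tagged division is a finite set of pairs; a bijection with \<open>{..<card I}\<close> transfers
  the estimate.\<close>

lemma abs_cont_onE_finite:
  assumes F: "abs_cont_on a b F" and "\<epsilon> > 0"
  obtains \<delta> where "\<delta> > 0"
    and "\<And>(I::'i set) u v. \<lbrakk>finite I; \<And>i. i \<in> I \<Longrightarrow> a \<le> u i \<and> u i \<le> v i \<and> v i \<le> b;
      disjoint_family_on (\<lambda>i. {u i<..<v i}) I; (\<Sum>i\<in>I. v i - u i) < \<delta>\<rbrakk>
      \<Longrightarrow> (\<Sum>i\<in>I. \<bar>F (v i) - F (u i)\<bar>) < \<epsilon>"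
proof -
  obtain \<delta> where "\<delta> > 0" and \<delta>: "\<forall>(m::nat) u v.
        (\<forall>i<m. a \<le> u i \<and> u i \<le> v i \<and> v i \<le> b) \<and>
        (\<forall>i<m. \<forall>j<m. i \<noteq> j \<longrightarrow> {u i<..<v i} \<inter> {u j<..<v j} = {}) \<and>
        (\<Sum>i<m. v i - u i) < \<delta> \<longrightarrow> (\<Sum>i<m. \<bar>F (v i) - F (u i)\<bar>) < \<epsilon>"
    using F[unfolded abs_cont_on_def, rule_format, OF \<open>\<epsilon> > 0\<close>] by (elim exE conjE)
  show thesis
  proof (rule that[OF \<open>\<delta> > 0\<close>])
    fix I :: "'i set" and u v
    assume I: "finite I" and uv: "\<And>i. i \<in> I \<Longrightarrow> a \<le> u i \<and> u i \<le> v i \<and> v i \<le> b"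
      and dj: "disjoint_family_on (\<lambda>i. {u i<..<v i}) I" and s: "(\<Sum>i\<in>I. v i - u i) < \<delta>"
    obtain h where h: "bij_betw h {..<card I} I"
      using ex_bij_betw_nat_finite[OF I] by (auto simp: atLeast0LessThan)
    have hI: "h i \<in> I" if "i < card I" for i
      using h that by (auto simp: bij_betw_def)
    have "(\<Sum>i<card I. \<bar>F (v (h i)) - F (u (h i))\<bar>) < \<epsilon>"
    proof (rule \<delta>[rule_format], intro conjI)
      show "\<forall>i<card I. a \<le> u (h i) \<and> u (h i) \<le> v (h i) \<and> v (h i) \<le> b"
        using uv hI by blast
      show "\<forall>i<card I. \<forall>j<card I. i \<noteq> j \<longrightarrow> {u (h i)<..<v (h i)} \<inter> {u (h j)<..<v (h j)} = {}"
      proof (intro allI impI)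
        fix i j assume ij: "i < card I" "j < card I" "i \<noteq> j"
        then have "h i \<noteq> h j"
          using h by (auto simp: bij_betw_def inj_on_def)
        then show "{u (h i)<..<v (h i)} \<inter> {u (h j)<..<v (h j)} = {}"
          using dj hI ij unfolding disjoint_family_on_def by blast
      qed
      show "(\<Sum>i<card I. v (h i) - u (h i)) < \<delta>"
        using s sum.reindex_bij_betw[OF h, of "\<lambda>i. v i - u i"] by simp
    qed
    then show "(\<Sum>i\<in>I. \<bar>F (v i) - F (u i)\<bar>) < \<epsilon>"
      using sum.reindex_bij_betw[OF h, of "\<lambda>i. \<bar>F (v i) - F (u i)\<bar>"] by simp
  qed
qed

text \<open>The exceptional null set is covered by an open set of small measure; the intervals of a fine
  tagged division whose tags lie in the null set then contribute little, by absolute continuity.\<close>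

theorem has_integral_abs_cont_on:
  fixes F f :: "real \<Rightarrow> real"
  assumes "a \<le> b" and F: "abs_cont_on a b F" and S: "negligible S"
    and deriv: "\<And>x. x \<in> {a..b} - S \<Longrightarrow> (F has_vector_derivative f x) (at x within {a..b})"
  shows "(f has_integral F b - F a) {a..b}"
proof -
  \<comment> \<open>Setting the integrand to 0 on \<open>S\<close> removes the terms tagged in
    \<open>S\<close> from every Riemann sum; the original values return at the end by a change on a
    negligible set.\<close>
  define g where "g x = (if x \<in> S then 0 else f x)" for x
  have "(g has_integral F b - F a) (cbox a b)"
    unfolding has_integral
  proof (intro allI impI)
    fix e :: real assume "e > 0"
    obtain \<delta> where "\<delta> > 0" and \<delta>: "\<And>(I::(real \<times> real set) set) u v. \<lbrakk>finite I; \<And>i. i \<in> I \<Longrightarrow> a \<le> u i \<and> u i \<le> v i \<and> v i \<le> b;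
      disjoint_family_on (\<lambda>i. {u i<..<v i}) I; (\<Sum>i\<in>I. v i - u i) < \<delta>\<rbrakk>
      \<Longrightarrow> (\<Sum>i\<in>I. \<bar>F (v i) - F (u i)\<bar>) < e / 2"
      using abs_cont_onE_finite[OF F, of "e/2"] \<open>e > 0\<close> half_gt_zero by blast
    obtain T where T: "open T" "S \<subseteq> T" "T - S \<in> lmeasurable" "emeasure lebesgue (T - S) < ennreal \<delta>"
      using sets_lebesgue_outer_open[OF negligible_imp_sets[OF S] \<open>\<delta> > 0\<close>] by blast
    have T_meas: "T \<in> lmeasurable" "measure lebesgue T < \<delta>"
    proof -
      have "T = (T - S) \<union> S" using T by blast
      moreover have "S \<in> lmeasurable" "measure lebesgue S = 0"
        using S by (simp_all add: negligible_imp_measurable negligible_imp_measure0)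
      ultimately show "T \<in> lmeasurable" 
        using T(3) fmeasurable.Un by metis
      have "measure lebesgue T \<le> measure lebesgue (T - S) + measure lebesgue S"
        using \<open>T = (T - S) \<union> S\<close> T(3) \<open>S \<in> lmeasurable\<close> measure_Un_le fmeasurableD by metis
      moreover have "measure lebesgue (T - S) < \<delta>"
        using T(3,4) \<open>\<delta> > 0\<close> by (simp add: emeasure_eq_measure2 ennreal_less_iff)
      ultimately show "measure lebesgue T < \<delta>"
        using \<open>measure lebesgue S = 0\<close> by simp
    qed
    \<comment> \<open>Chosen so that \<open>e' * (b - a)\<close> stays below \<open>e / 2\<close>;
      the summand 1 keeps the denominator positive when \<open>a = b\<close>.\<close>
    define e' where "e' = e / (2 * (b - a + 1))"
    have "e' > 0" using \<open>e > 0\<close> \<open>a \<le> b\<close> by (simp add: e'_def)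
    have "\<forall>x. \<exists>d>0. x \<in> {a..b} - S \<longrightarrow>
         (\<forall>y\<in>{a..b}. norm (y-x) < d \<longrightarrow> norm (F y - F x - (y-x) *\<^sub>R f x) \<le> e' * norm (y-x))"
      using deriv[unfolded has_vector_derivative_def has_derivative_within_alt] \<open>e' > 0\<close>
      by (metis zero_less_one)
    then obtain d where d0: "\<And>x. 0 < d x"
      and d: "\<And>x y. \<lbrakk>x \<in> {a..b} - S; y \<in> {a..b}; norm (y-x) < d x\<rbrakk>
                        \<Longrightarrow> norm (F y - F x - (y-x) *\<^sub>R f x) \<le> e' * norm (y-x)"
      by metis
    define \<gamma> where "\<gamma> x = (if x \<in> S then T else ball x (d x))" for x
    have "gauge \<gamma>"
      using T d0 unfolding gauge_def \<gamma>_def by auto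
    moreover have "norm ((\<Sum>(x,K)\<in>p. measure lborel K *\<^sub>R g x) - (F b - F a)) < e"
      if p: "p tagged_division_of cbox a b" and fine: "\<gamma> fine p" for p
    proof -
      have fin: "finite p" using p by blast
      define p1 where "p1 = {(x,K) \<in> p. x \<notin> S}"
      define p2 where "p2 = {(x,K) \<in> p. x \<in> S}"
      have p12: "p = p1 \<union> p2" "p1 \<inter> p2 = {}" "finite p1" "finite p2"
        using fin by (auto simp: p1_def p2_def intro: rev_finite_subset)
      have ba: "b - a = (\<Sum>(x,K)\<in>p. Sup K - Inf K)" and Fba: "F b - F a = (\<Sum>(x,K)\<in>p. F (Sup K) - F (Inf K))"
        using additive_tagged_division_1[where f= "\<lambda>x. x"] additive_tagged_division_1[where f= F]
              \<open>a \<le> b\<close> p by auto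
      have K: "\<exists>u v. K = {u..v} \<and> u \<le> v \<and> Inf K = u \<and> Sup K = v \<and> a \<le> u \<and> v \<le> b \<and> x \<in> {u..v}
          \<and> {u..v} \<subseteq> \<gamma> x \<and> measure lborel K = v - u"
        if xK: "(x,K) \<in> p" for x K
      proof -
        have "x \<in> K" "K \<subseteq> {a..b}" "\<exists>u v. K = cbox u v"
          using tagged_division_ofD[OF p] xK by auto
        then obtain u v where uv: "K = {u..v}" by auto
        have "K \<subseteq> \<gamma> x" using fine xK by blast
        then show ?thesis
          using \<open>x \<in> K\<close> \<open>K \<subseteq> {a..b}\<close> uv by (intro exI[of _ u] exI[of _ v]) auto
      qed
      have K': "interior K = {Inf K<..<Sup K} \<and> Inf K \<le> Sup K \<and> a \<le> Inf K \<and> Sup K \<le> b \<and> {Inf K<..<Sup K} \<subseteq> \<gamma> x"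
        if xK: "(x,K) \<in> p" for x K
      proof -
        obtain u v where "K = {u..v}" "u \<le> v" "Inf K = u" "Sup K = v" "a \<le> u" "v \<le> b" "{u..v} \<subseteq> \<gamma> x"
          using K[OF xK] by blast
        moreover have "{u<..<v} \<subseteq> {u..v}" by auto
        ultimately show ?thesis by (metis interior_atLeastAtMost_real order_trans)
      qed
      have 1: "norm (\<Sum>(x,K)\<in>p1. measure lborel K *\<^sub>R g x - (F (Sup K) - F (Inf K))) \<le> (\<Sum>(x,K)\<in>p1. e' * (Sup K - Inf K))"
      proof (rule order_trans[OF norm_sum sum_mono], clarify)
        fix x K assume "(x,K) \<in> p1"
        then have xp: "(x,K) \<in> p" "x \<notin> S" by (auto simp: p1_def)
        obtain u v where uv: "K = {u..v}" "u \<le> v" "Inf K = u" "Sup K = v" "a \<le> u" "v \<le> b" "x \<in> {u..v}"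
          "{u..v} \<subseteq> \<gamma> x" "measure lborel K = v - u"
          using K[OF xp(1)] by blast
        have "u \<in> \<gamma> x" "v \<in> \<gamma> x" using uv by auto
        then have "norm (u - x) < d x" "norm (v - x) < d x"
          using xp by (auto simp: \<gamma>_def dist_real_def)
        then have "norm (F u - F x - (u-x) *\<^sub>R f x) \<le> e' * norm (u-x)"
          "norm (F v - F x - (v-x) *\<^sub>R f x) \<le> e' * norm (v-x)"
          using d[of x u] d[of x v] uv xp by auto
        \<comment> \<open>The tag lies between \<open>u\<close> and \<open>v\<close>, so the two
          one-sided errors add up to at most \<open>e'\<close> times the length of the interval
          (straddle lemma).\<close>
        then have "norm ((v - u) * f x - (F v - F u)) \<le> e' * (x - u) + e' * (v - x)"
          unfolding real_norm_def abs_le_iff using uv by (auto simp: algebra_simps abs_le_iff)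
        then show "norm (measure lborel K *\<^sub>R g x - (F (Sup K) - F (Inf K))) \<le> e' * (Sup K - Inf K)"
          using uv xp by (simp add: g_def algebra_simps)
      qed
      have "(\<Sum>(x,K)\<in>p1. e' * (Sup K - Inf K)) \<le> (\<Sum>(x,K)\<in>p. e' * (Sup K - Inf K))"
      proof (rule sum_mono2[OF fin])
        show "p1 \<subseteq> p" using p12 by blast
        fix i assume "i \<in> p - p1"
        then show "0 \<le> (case i of (x,K) \<Rightarrow> e' * (Sup K - Inf K))"
          using K'[of "fst i" "snd i"] \<open>e' > 0\<close> by (auto simp: case_prod_unfold)
      qed
      also have "\<dots> = e' * (b - a)"
        unfolding ba by (simp add: sum_distrib_left case_prod_unfold)
      also have "\<dots> < e / 2"
        using \<open>e > 0\<close> \<open>a \<le> b\<close> by (simp add: e'_def field_simps)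
      finally have 2: "norm (\<Sum>(x,K)\<in>p1. measure lborel K *\<^sub>R g x - (F (Sup K) - F (Inf K))) < e / 2"
        using 1 by linarith
      have 3: "(\<Sum>i\<in>p2. \<bar>F (Sup (snd i)) - F (Inf (snd i))\<bar>) < e / 2"
      proof (rule \<delta>)
        show "finite p2" by fact
        show "a \<le> Inf (snd i) \<and> Inf (snd i) \<le> Sup (snd i) \<and> Sup (snd i) \<le> b" if "i \<in> p2" for i
          using K'[of "fst i" "snd i"] that by (auto simp: p2_def)
        show dj: "disjoint_family_on (\<lambda>i. {Inf (snd i)<..<Sup (snd i)}) p2"
          unfolding disjoint_family_on_def
        proof (intro ballI impI)
          fix i j assume ij: "i \<in> p2" "j \<in> p2" "i \<noteq> j"
          then have "i \<in> p" "j \<in> p" by (auto simp: p2_def)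
          then have "interior (snd i) \<inter> interior (snd j) = {}"
            using tagged_division_ofD(5)[OF p, of "fst i" "snd i" "fst j" "snd j"] ij(3) by auto
          moreover have "interior (snd i) = {Inf (snd i)<..<Sup (snd i)}"
            "interior (snd j) = {Inf (snd j)<..<Sup (snd j)}"
            using K'[of "fst i" "snd i"] K'[of "fst j" "snd j"] \<open>i \<in> p\<close> \<open>j \<in> p\<close> by simp_all
          ultimately show "{Inf (snd i)<..<Sup (snd i)} \<inter> {Inf (snd j)<..<Sup (snd j)} = {}"
            by simp
        qed
        have "(\<Sum>i\<in>p2. Sup (snd i) - Inf (snd i)) = (\<Sum>i\<in>p2. measure lebesgue {Inf (snd i)<..<Sup (snd i)})"
        proof (rule sum.cong[OF refl])
          fix i assume "i \<in> p2"
          then have "Inf (snd i) \<le> Sup (snd i)"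
            using K'[of "fst i" "snd i"] by (auto simp: p2_def)
          then show "Sup (snd i) - Inf (snd i) = measure lebesgue {Inf (snd i)<..<Sup (snd i)}"
            by simp
        qed
        also have "\<dots> = measure lebesgue (\<Union>i\<in>p2. {Inf (snd i)<..<Sup (snd i)})"
        proof (rule measure_finite_Union[symmetric, OF \<open>finite p2\<close> _ dj])
          show "(\<lambda>i. {Inf (snd i)<..<Sup (snd i)}) ` p2 \<subseteq> sets lebesgue" by force
          show "emeasure lebesgue {Inf (snd i)<..<Sup (snd i)} \<noteq> \<infinity>" for i :: "real \<times> real set"
            using lmeasurable_box[of "Inf (snd i)" "Sup (snd i)"] fmeasurableD2 by fastforce
        qed
        also have "\<dots> \<le> measure lebesgue T"
        proof (rule measure_mono_fmeasurable)
          show "(\<Union>i\<in>p2. {Inf (snd i)<..<Sup (snd i)}) \<subseteq> T"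
          proof clarify
            fix x xa K assume "(xa,K) \<in> p2" "x \<in> {Inf (snd (xa,K))<..<Sup (snd (xa,K))}"
            then show "x \<in> T" using K'[of xa K] by (auto simp: p2_def \<gamma>_def)
          qed
          show "(\<Union>i\<in>p2. {Inf (snd i)<..<Sup (snd i)}) \<in> sets lebesgue"
            using \<open>finite p2\<close> by (intro sets.finite_UN) simp_all
        qed (rule T_meas)
        also have "\<dots> < \<delta>" by (rule T_meas)
        finally show "(\<Sum>i\<in>p2. Sup (snd i) - Inf (snd i)) < \<delta>" .
      qed
      have 4: "norm (\<Sum>(x,K)\<in>p2. measure lborel K *\<^sub>R g x - (F (Sup K) - F (Inf K))) \<le> (\<Sum>i\<in>p2. \<bar>F (Sup (snd i)) - F (Inf (snd i))\<bar>)"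
        by (rule order_trans[OF norm_sum sum_mono]) (auto simp: p2_def g_def)
      have "(\<Sum>(x,K)\<in>p. measure lborel K *\<^sub>R g x) - (F b - F a) = (\<Sum>(x,K)\<in>p. measure lborel K *\<^sub>R g x - (F (Sup K) - F (Inf K)))"
        unfolding Fba by (simp add: sum_subtractf case_prod_unfold)
      also have "\<dots> = (\<Sum>(x,K)\<in>p1. measure lborel K *\<^sub>R g x - (F (Sup K) - F (Inf K))) + (\<Sum>(x,K)\<in>p2. measure lborel K *\<^sub>R g x - (F (Sup K) - F (Inf K)))"
        using p12 by (simp add: sum.union_disjoint)
      finally show ?thesis
        using norm_triangle_lt[OF add_strict_mono[OF 2 le_less_trans[OF 4 3], unfolded field_sum_of_halves]] by simp
    qed
    ultimately have "gauge \<gamma> \<and> (\<forall>p. p tagged_division_of cbox a b \<and> \<gamma> fine p \<longrightarrow>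
        norm ((\<Sum>(x,K)\<in>p. measure lborel K *\<^sub>R g x) - (F b - F a)) < e)"
      by simp
    then show "\<exists>\<gamma>. gauge \<gamma> \<and> (\<forall>p. p tagged_division_of cbox a b \<and> \<gamma> fine p \<longrightarrow>
        norm ((\<Sum>(x,K)\<in>p. measure lborel K *\<^sub>R g x) - (F b - F a)) < e)"
      by (rule exI[where x = \<gamma>])
  qed
  then have "(g has_integral F b - F a) {a..b}" by simp
  then show ?thesis
    by (rule has_integral_spike[OF S, rotated]) (auto simp: g_def)
qed

section \<open>Lipschitz functions and closure properties of absolute continuity\<close>

lemma abs_cont_on_lipschitz:
  assumes "\<And>x y. a \<le> x \<Longrightarrow> x \<le> y \<Longrightarrow> y \<le> b \<Longrightarrow> \<bar>F y - F x\<bar> \<le> C * (y - x)"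
  shows "abs_cont_on a b F"
  unfolding abs_cont_on_def
proof (intro allI impI)
  fix \<epsilon> :: real assume "\<epsilon> > 0"
  define \<delta> where "\<delta> = \<epsilon> / (\<bar>C\<bar> + 1)"
  have "\<delta> > 0" using \<open>\<epsilon> > 0\<close> by (simp add: \<delta>_def add_nonneg_pos)
  moreover have "(\<Sum>i<m. \<bar>F (v i) - F (u i)\<bar>) < \<epsilon>"
    if uv: "\<forall>i<m. a \<le> u i \<and> u i \<le> v i \<and> v i \<le> b" and s: "(\<Sum>i<m. v i - u i) < \<delta>" for m :: nat and u v
  proof -
    have "(\<Sum>i<m. \<bar>F (v i) - F (u i)\<bar>) \<le> (\<Sum>i<m. (\<bar>C\<bar> + 1) * (v i - u i))"
    proof (rule sum_mono)
      fix i assume "i \<in> {..<m}"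
      then have i: "a \<le> u i" "u i \<le> v i" "v i \<le> b" using uv by auto
      have "\<bar>F (v i) - F (u i)\<bar> \<le> C * (v i - u i)" by (rule assms) (use i in auto)
      also have "\<dots> \<le> (\<bar>C\<bar> + 1) * (v i - u i)" using i by (intro mult_right_mono) auto
      finally show "\<bar>F (v i) - F (u i)\<bar> \<le> (\<bar>C\<bar> + 1) * (v i - u i)" .
    qed
    also have "\<dots> = (\<bar>C\<bar> + 1) * (\<Sum>i<m. v i - u i)" by (simp only: sum_distrib_left)
    also have "\<dots> < (\<bar>C\<bar> + 1) * \<delta>" using s by (intro mult_strict_left_mono) auto
    also have "\<dots> = \<epsilon>" by (simp add: \<delta>_def)
    finally show ?thesis .
  qed
  ultimately show "\<exists>\<delta>>0. \<forall>(m::nat) u v. (\<forall>i<m. a \<le> u i \<and> u i \<le> v i \<and> v i \<le> b) \<and>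
        (\<forall>i<m. \<forall>j<m. i \<noteq> j \<longrightarrow> {u i<..<v i} \<inter> {u j<..<v j} = {}) \<and>
        (\<Sum>i<m. v i - u i) < \<delta> \<longrightarrow> (\<Sum>i<m. \<bar>F (v i) - F (u i)\<bar>) < \<epsilon>"
    by (intro exI[where x = \<delta>] conjI allI impI; (elim conjE)?)
qed

lemma abs_cont_on_imp_continuous_on:
  assumes F: "abs_cont_on a b F"
  shows "continuous_on {a..b} F"
  unfolding continuous_on_iff
proof (intro ballI allI impI)
  fix x e :: real assume x: "x \<in> {a..b}" and "e > 0"
  obtain \<delta> where "\<delta> > 0" and \<delta>: "\<forall>(m::nat) u v.
        (\<forall>i<m. a \<le> u i \<and> u i \<le> v i \<and> v i \<le> b) \<and>
        (\<forall>i<m. \<forall>j<m. i \<noteq> j \<longrightarrow> {u i<..<v i} \<inter> {u j<..<v j} = {}) \<and>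
        (\<Sum>i<m. v i - u i) < \<delta> \<longrightarrow> (\<Sum>i<m. \<bar>F (v i) - F (u i)\<bar>) < e"
    using F[unfolded abs_cont_on_def, rule_format, OF \<open>e > 0\<close>] by (elim exE conjE)
  have "dist (F y) (F x) < e" if "y \<in> {a..b}" "dist y x < \<delta>" for y
    using \<delta>[rule_format, of 1 "\<lambda>_. x" "\<lambda>_. y"] \<delta>[rule_format, of 1 "\<lambda>_. y" "\<lambda>_. x"] that x
    by (cases "x \<le> y") (auto simp: dist_real_def abs_minus_commute)
  then show "\<exists>d>0. \<forall>x'\<in>{a..b}. dist x' x < d \<longrightarrow> dist (F x') (F x) < e"
    using \<open>\<delta> > 0\<close> by auto
qed

lemma abs_cont_on_bounded:
  assumes "abs_cont_on a b F"
  obtains M where "M > 0" "\<And>x. x \<in> {a..b} \<Longrightarrow> \<bar>F x\<bar> \<le> M"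
proof -
  have "bounded (F ` {a..b})"
    by (intro compact_imp_bounded compact_continuous_image abs_cont_on_imp_continuous_on assms) simp
  then show thesis
    unfolding bounded_pos using that by auto
qed

text \<open>The tolerance is split into two halves, one for each controlling function. Sums use this
  with \<open>M = 1\<close>, products with a common bound of both factors.\<close>

lemma abs_cont_on_dominated:
  assumes F: "abs_cont_on a b F" and G: "abs_cont_on a b G" and M: "M > 0"
    and H: "\<And>x y. a \<le> x \<Longrightarrow> x \<le> y \<Longrightarrow> y \<le> b \<Longrightarrow> \<bar>H y - H x\<bar> \<le> M * \<bar>F y - F x\<bar> + M * \<bar>G y - G x\<bar>"
  shows "abs_cont_on a b H"
  unfolding abs_cont_on_def
proof (intro allI impI)
  fix \<epsilon> :: real assume "\<epsilon> > 0"
  then have e: "\<epsilon> / (2 * M) > 0" using M by simp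
  obtain \<delta>1 where "\<delta>1 > 0" and \<delta>1: "\<forall>(m::nat) u v.
        (\<forall>i<m. a \<le> u i \<and> u i \<le> v i \<and> v i \<le> b) \<and>
        (\<forall>i<m. \<forall>j<m. i \<noteq> j \<longrightarrow> {u i<..<v i} \<inter> {u j<..<v j} = {}) \<and>
        (\<Sum>i<m. v i - u i) < \<delta>1 \<longrightarrow> (\<Sum>i<m. \<bar>F (v i) - F (u i)\<bar>) < \<epsilon> / (2 * M)"
    using F[unfolded abs_cont_on_def, rule_format, OF e] by (elim exE conjE)
  obtain \<delta>2 where "\<delta>2 > 0" and \<delta>2: "\<forall>(m::nat) u v.
        (\<forall>i<m. a \<le> u i \<and> u i \<le> v i \<and> v i \<le> b) \<and>
        (\<forall>i<m. \<forall>j<m. i \<noteq> j \<longrightarrow> {u i<..<v i} \<inter> {u j<..<v j} = {}) \<and>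
        (\<Sum>i<m. v i - u i) < \<delta>2 \<longrightarrow> (\<Sum>i<m. \<bar>G (v i) - G (u i)\<bar>) < \<epsilon> / (2 * M)"
    using G[unfolded abs_cont_on_def, rule_format, OF e] by (elim exE conjE)
  have "(\<Sum>i<m. \<bar>H (v i) - H (u i)\<bar>) < \<epsilon>"
    if uv: "\<forall>i<m. a \<le> u i \<and> u i \<le> v i \<and> v i \<le> b"
      and dj: "\<forall>i<m. \<forall>j<m. i \<noteq> j \<longrightarrow> {u i<..<v i} \<inter> {u j<..<v j} = {}"
      and s: "(\<Sum>i<m. v i - u i) < min \<delta>1 \<delta>2" for m :: nat and u v
  proof -
    have "(\<Sum>i<m. \<bar>H (v i) - H (u i)\<bar>) \<le> (\<Sum>i<m. M * \<bar>F (v i) - F (u i)\<bar> + M * \<bar>G (v i) - G (u i)\<bar>)"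
      using uv by (intro sum_mono H) auto
    also have "\<dots> = M * (\<Sum>i<m. \<bar>F (v i) - F (u i)\<bar>) + M * (\<Sum>i<m. \<bar>G (v i) - G (u i)\<bar>)"
      by (simp only: sum.distrib sum_distrib_left)
    also have "\<dots> < M * (\<epsilon> / (2 * M)) + M * (\<epsilon> / (2 * M))"
    proof (intro add_strict_mono mult_strict_left_mono M)
      show "(\<Sum>i<m. \<bar>F (v i) - F (u i)\<bar>) < \<epsilon> / (2 * M)"
        using \<delta>1[rule_format, of m u v] uv dj s by simp
      show "(\<Sum>i<m. \<bar>G (v i) - G (u i)\<bar>) < \<epsilon> / (2 * M)"
        using \<delta>2[rule_format, of m u v] uv dj s by simp
    qed
    also have "\<dots> = \<epsilon>" using M by (simp add: field_simps)
    finally show ?thesis .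
  qed
  then show "\<exists>\<delta>>0. \<forall>(m::nat) u v. (\<forall>i<m. a \<le> u i \<and> u i \<le> v i \<and> v i \<le> b) \<and>
        (\<forall>i<m. \<forall>j<m. i \<noteq> j \<longrightarrow> {u i<..<v i} \<inter> {u j<..<v j} = {}) \<and>
        (\<Sum>i<m. v i - u i) < \<delta> \<longrightarrow> (\<Sum>i<m. \<bar>H (v i) - H (u i)\<bar>) < \<epsilon>"
    using \<open>\<delta>1 > 0\<close> \<open>\<delta>2 > 0\<close>
    by (intro exI[where x = "min \<delta>1 \<delta>2"] conjI allI impI; (elim conjE)?) simp_all
qed

lemma abs_cont_on_const: "abs_cont_on a b (\<lambda>x. c)"
  by (rule abs_cont_on_lipschitz[where C = 0]) simp

lemma abs_cont_on_id: "abs_cont_on a b (\<lambda>x. x)"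
  by (rule abs_cont_on_lipschitz[where C = 1]) simp

lemma abs_cont_on_add:
  assumes "abs_cont_on a b F" "abs_cont_on a b G"
  shows "abs_cont_on a b (\<lambda>x. F x + G x)"
  by (rule abs_cont_on_dominated[OF assms, of 1]) auto

lemma abs_cont_on_mult:
  assumes F: "abs_cont_on a b F" and G: "abs_cont_on a b G"
  shows "abs_cont_on a b (\<lambda>x. F x * G x)"
proof -
  obtain M where M: "M > 0" "\<And>x. x \<in> {a..b} \<Longrightarrow> \<bar>F x\<bar> \<le> M"
    using abs_cont_on_bounded[OF F] by blast
  obtain M' where M': "M' > 0" "\<And>x. x \<in> {a..b} \<Longrightarrow> \<bar>G x\<bar> \<le> M'"
    using abs_cont_on_bounded[OF G] by blast
  show ?thesis
  proof (rule abs_cont_on_dominated[OF F G])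
    show "max M M' > 0" using M by simp
    fix x y assume xy: "a \<le> x" "x \<le> y" "y \<le> b"
    have "\<bar>F y * G y - F x * G x\<bar> = \<bar>G y * (F y - F x) + F x * (G y - G x)\<bar>"
      by (simp add: algebra_simps)
    also have "\<dots> \<le> \<bar>G y\<bar> * \<bar>F y - F x\<bar> + \<bar>F x\<bar> * \<bar>G y - G x\<bar>"
      using abs_triangle_ineq[of "G y * (F y - F x)" "F x * (G y - G x)"] by (simp add: abs_mult)
    also have "\<dots> \<le> max M M' * \<bar>F y - F x\<bar> + max M M' * \<bar>G y - G x\<bar>"
      using M(2)[of x] M'(2)[of y] xy by (intro add_mono mult_right_mono) auto
    finally show "\<bar>F y * G y - F x * G x\<bar> \<le> max M M' * \<bar>F y - F x\<bar> + max M M' * \<bar>G y - G x\<bar>" .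
  qed
qed

lemma abs_cont_on_power: "abs_cont_on a b F \<Longrightarrow> abs_cont_on a b (\<lambda>x. F x ^ k)"
  by (induction k) (auto intro: abs_cont_on_const abs_cont_on_mult)

lemma abs_cont_on_sum:
  "(\<And>i. i \<in> I \<Longrightarrow> abs_cont_on a b (F i)) \<Longrightarrow> abs_cont_on a b (\<lambda>x. \<Sum>i\<in>I. F i x)"
  by (induction I rule: infinite_finite_induct) (auto intro: abs_cont_on_const abs_cont_on_add)

lemma abs_cont_on_poly: "abs_cont_on a b (poly p)"
  by (induction p) (auto intro!: abs_cont_on_const abs_cont_on_add abs_cont_on_mult abs_cont_on_id)

lemma abs_cont_on_pos_part: "abs_cont_on a b (\<lambda>x. max 0 (x - c))"
  by (rule abs_cont_on_lipschitz[where C = 1]) auto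

lemma abs_cont_on_subinterval:
  assumes F: "abs_cont_on a b F" and "a \<le> a'" "b' \<le> b"
  shows "abs_cont_on a' b' F"
  unfolding abs_cont_on_def
proof (intro allI impI)
  fix \<epsilon> :: real assume "\<epsilon> > 0"
  obtain \<delta> where "\<delta> > 0" and \<delta>: "\<forall>(m::nat) u v.
        (\<forall>i<m. a \<le> u i \<and> u i \<le> v i \<and> v i \<le> b) \<and>
        (\<forall>i<m. \<forall>j<m. i \<noteq> j \<longrightarrow> {u i<..<v i} \<inter> {u j<..<v j} = {}) \<and>
        (\<Sum>i<m. v i - u i) < \<delta> \<longrightarrow> (\<Sum>i<m. \<bar>F (v i) - F (u i)\<bar>) < \<epsilon>"
    using F[unfolded abs_cont_on_def, rule_format, OF \<open>\<epsilon> > 0\<close>] by (elim exE conjE)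
  show "\<exists>\<delta>>0. \<forall>(m::nat) u v. (\<forall>i<m. a' \<le> u i \<and> u i \<le> v i \<and> v i \<le> b') \<and>
        (\<forall>i<m. \<forall>j<m. i \<noteq> j \<longrightarrow> {u i<..<v i} \<inter> {u j<..<v j} = {}) \<and>
        (\<Sum>i<m. v i - u i) < \<delta> \<longrightarrow> (\<Sum>i<m. \<bar>F (v i) - F (u i)\<bar>) < \<epsilon>"
  proof (intro exI[where x = \<delta>] conjI allI impI)
    fix m :: nat and u v :: "nat \<Rightarrow> real"
    assume "(\<forall>i<m. a' \<le> u i \<and> u i \<le> v i \<and> v i \<le> b') \<and>
        (\<forall>i<m. \<forall>j<m. i \<noteq> j \<longrightarrow> {u i<..<v i} \<inter> {u j<..<v j} = {}) \<and> (\<Sum>i<m. v i - u i) < \<delta>"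
    then show "(\<Sum>i<m. \<bar>F (v i) - F (u i)\<bar>) < \<epsilon>"
      using \<delta>[rule_format, of m u v] \<open>a \<le> a'\<close> \<open>b' \<le> b\<close> by (metis order_trans)
  qed fact
qed

section \<open>Integration by parts in \<open>W0\<close>\<close>

lemma higher_pderiv_eq_0: "degree p < n \<Longrightarrow> (pderiv ^^ n) p = (0 :: 'a :: {comm_semiring_1,semiring_no_zero_divisors,semiring_char_0} poly)"
proof (induction n arbitrary: p)
  case (Suc n)
  show ?case
  proof (cases "degree p = 0")
    case True
    then have "pderiv p = 0" by (simp add: pderiv_eq_0_iff)
    then show ?thesis by (simp add: funpow_Suc_right del: funpow.simps)
  next
    case False
    with Suc.prems have "degree (pderiv p) < n" by (simp add: degree_pderiv)
    then show ?thesis using Suc.IH by (simp add: funpow_Suc_right del: funpow.simps)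
  qed
qed simp

text \<open>\<open>\<Psi>\<close> is the whole boundary expression of \<open>n\<close> integrations
  by parts. Its derivative telescopes to \<open>F n x * poly q x\<close>, because the derivative of
  order \<open>n\<close> of \<open>q\<close> vanishes, so the fundamental theorem is applied only
  once.\<close>

theorem has_integral_iterated_by_parts:
  fixes F :: "nat \<Rightarrow> real \<Rightarrow> real"
  assumes "a \<le> b" and ac: "\<And>j. j < n \<Longrightarrow> abs_cont_on a b (F j)" and S: "negligible S"
    and deriv: "\<And>j x. j < n \<Longrightarrow> x \<in> {a..b} - S \<Longrightarrow> (F j has_vector_derivative F (Suc j) x) (at x within {a..b})"
    and deg: "degree q < n"
  defines "\<Psi> \<equiv> \<lambda>x. \<Sum>j<n. (-1) ^ j * F (n - Suc j) x * poly ((pderiv ^^ j) q) x"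
  shows "((\<lambda>x. F n x * poly q x) has_integral \<Psi> b - \<Psi> a) {a..b}"
proof (rule has_integral_abs_cont_on[OF \<open>a \<le> b\<close> _ S])
  show "abs_cont_on a b \<Psi>"
    unfolding \<Psi>_def by (intro abs_cont_on_sum abs_cont_on_mult abs_cont_on_const abs_cont_on_poly ac) auto
  fix x assume x: "x \<in> {a..b} - S"
  define B where "B j = (-1) ^ j * F (n - j) x * poly ((pderiv ^^ j) q) x" for j
  have "(\<Psi> has_real_derivative (\<Sum>j<n. B j - B (Suc j))) (at x within {a..b})"
    unfolding \<Psi>_def
  proof (rule DERIV_sum)
    fix j assume "j \<in> {..<n}"
    then have j: "j < n" and e: "Suc (n - Suc j) = n - j" by auto
    have F: "(F (n - Suc j) has_real_derivative F (n - j) x) (at x within {a..b})"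
      using deriv[of "n - Suc j" x] x j unfolding e has_real_derivative_iff_has_vector_derivative by simp
    have "(poly ((pderiv ^^ j) q) has_real_derivative poly ((pderiv ^^ Suc j) q) x) (at x within {a..b})"
      by (auto intro!: has_field_derivative_at_within poly_DERIV)
    from DERIV_mult[OF DERIV_cmult[OF F] this]
    show "((\<lambda>x. (-1) ^ j * F (n - Suc j) x * poly ((pderiv ^^ j) q) x) has_real_derivative B j - B (Suc j))
      (at x within {a..b})"
      by (rule DERIV_cong) (simp add: B_def algebra_simps)
  qed
  also have "(\<Sum>j<n. B j - B (Suc j)) = B 0 - B n"
    by (rule sum_lessThan_telescope')
  also have "\<dots> = F n x * poly q x"
    using higher_pderiv_eq_0[OF deg] by (simp add: B_def)
  finally show "(\<Psi> has_vector_derivative F n x * poly q x) (at x within {a..b})"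
    by (simp add: has_real_derivative_iff_has_vector_derivative)
qed

lemma has_integral_poly_by_parts:
  fixes p q :: "real poly"
  assumes "a \<le> b" and "degree q < n"
  shows "((\<lambda>x. poly ((pderiv ^^ n) p) x * poly q x) has_integral
    (\<Sum>j<n. (-1) ^ j * poly ((pderiv ^^ (n - Suc j)) p) b * poly ((pderiv ^^ j) q) b)
    - (\<Sum>j<n. (-1) ^ j * poly ((pderiv ^^ (n - Suc j)) p) a * poly ((pderiv ^^ j) q) a)) {a..b}"
  by (rule has_integral_iterated_by_parts[where F = "\<lambda>j. poly ((pderiv ^^ j) p)", OF \<open>a \<le> b\<close> _ negligible_empty _ assms(2)])
     (auto intro!: abs_cont_on_poly has_field_derivative_at_within poly_DERIV
        simp flip: has_real_derivative_iff_has_vector_derivative)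

text \<open>Only the derivative of order \<open>n - 1\<close> can fail to be differentiable
  somewhere, so one exceptional null set serves all orders.\<close>

lemma W0_has_vector_derivative:
  assumes f: "f \<in> W0 n"
  shows "\<exists>S. negligible S \<and> (\<forall>j<n. \<forall>x\<in>{0..1} - S.
      (deriv01 j f has_vector_derivative deriv01 (Suc j) f x) (at x within {0..1}))"
proof -
  have "AE x in lebesgue_on {0..1}. deriv01 (n - 1) f differentiable (at x within {0..1})"
    using f by (simp add: W0_def)
  then have "AE x in lebesgue. x \<in> {0..1} \<longrightarrow> deriv01 (n - 1) f differentiable (at x within {0..1})"
    by (simp add: AE_restrict_space_iff)
  then obtain N where N: "N \<in> null_sets lebesgue"
    "{x. \<not> (x \<in> {0..1} \<longrightarrow> deriv01 (n - 1) f differentiable (at x within {0..1}))} \<subseteq> N"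
    unfolding eventually_ae_filter by auto
  show ?thesis
  proof (intro exI[where x = N] conjI allI impI ballI)
    show "negligible N" using N by (simp add: negligible_iff_null_sets)
    fix j x assume j: "j < n" and x: "x \<in> {0..1} - N"
    have "deriv01 j f differentiable (at x within {0..1})"
    proof (cases "j + 1 < n")
      case True then show ?thesis using f x by (simp add: W0_def)
    next
      case False
      with j have "j = n - 1" by simp
      then show ?thesis using N x by blast
    qed
    then show "(deriv01 j f has_vector_derivative deriv01 (Suc j) f x) (at x within {0..1})"
      by (simp add: vector_derivative_works deriv01_def)
  qed
qed

text \<open>The boundary terms at 0 vanish by definition of the space. Those at \<open>c\<close>
  remain, which later allows evaluation at an interior point.\<close>

lemma W0_pairing:
  assumes f: "f \<in> W0 n" and c: "0 \<le> c" "c \<le> 1" and deg: "degree q < n"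
  shows "((\<lambda>x. deriv01 n f x * poly q x) has_integral
    (\<Sum>j<n. (-1) ^ j * deriv01 (n - Suc j) f c * poly ((pderiv ^^ j) q) c)) {0..c}"
proof -
  from W0_has_vector_derivative[OF f] obtain S where *: "negligible S \<and> (\<forall>j<n. \<forall>x\<in>{0..1} - S.
      (deriv01 j f has_vector_derivative deriv01 (Suc j) f x) (at x within {0..1}))" ..
  note S = *[THEN conjunct1] and d = *[THEN conjunct2, rule_format]
  have "((\<lambda>x. deriv01 n f x * poly q x) has_integral
    (\<Sum>j<n. (-1) ^ j * deriv01 (n - Suc j) f c * poly ((pderiv ^^ j) q) c)
    - (\<Sum>j<n. (-1) ^ j * deriv01 (n - Suc j) f 0 * poly ((pderiv ^^ j) q) 0)) {0..c}"
  proof (rule has_integral_iterated_by_parts[where a = 0 and b = c and n = n and q = q and F = "\<lambda>j. deriv01 j f", OF c(1) _ S _ deg])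
    show "abs_cont_on 0 c (deriv01 j f)" if "j < n" for j
      by (rule abs_cont_on_subinterval[of 0 1]) (use f that c in \<open>auto simp: W0_def\<close>)
    show "(deriv01 j f has_vector_derivative deriv01 (Suc j) f x) (at x within {0..c})"
      if "j < n" "x \<in> {0..c} - S" for j x
      using that c by (intro has_vector_derivative_within_subset[OF d]) auto
  qed
  moreover have "(\<Sum>j<n. (-1) ^ j * deriv01 (n - Suc j) f 0 * poly ((pderiv ^^ j) q) 0) = 0"
    using f by (intro sum.neutral) (auto simp: W0_def)
  ultimately show ?thesis by simp
qed

section \<open>Taylor kernels and evaluation of derivatives\<close>

definition taylor_poly :: "nat \<Rightarrow> real \<Rightarrow> real poly" where
  "taylor_poly m a = smult (1 / fact m) ([:a, -1:] ^ m)"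

lemma poly_taylor_poly: "poly (taylor_poly m a) x = (a - x) ^ m / fact m"
  by (simp add: taylor_poly_def)

lemma degree_taylor_poly: "degree (taylor_poly m a) = m"
  by (simp add: taylor_poly_def degree_power_eq)

lemma pderiv_taylor_poly: "pderiv (taylor_poly (Suc m) a) = - taylor_poly m a"
proof -
  have "real (Suc m) / fact (Suc m) = 1 / fact m" by (simp del: of_nat_Suc)
  then show ?thesis
    by (simp add: taylor_poly_def pderiv_smult pderiv_power_Suc pderiv_pCons del: power_Suc fact_Suc of_nat_Suc)
qed

lemma higher_pderiv_taylor_poly: "j \<le> m \<Longrightarrow> (pderiv ^^ j) (taylor_poly m a) = smult ((-1) ^ j) (taylor_poly (m - j) a)"
proof (induction j)
  case (Suc j)
  then have "m - j = Suc (m - Suc j)" by simp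
  then show ?case using Suc by (simp add: pderiv_smult pderiv_taylor_poly del: diff_Suc_Suc)
qed simp

lemma poly_higher_pderiv_taylor_poly:
  "poly ((pderiv ^^ j) (taylor_poly m a)) a = (if j = m then (-1) ^ m else 0)"
proof (cases "j \<le> m")
  case True
  then show ?thesis by (auto simp: higher_pderiv_taylor_poly poly_taylor_poly)
next
  case False
  then have "(pderiv ^^ j) (taylor_poly m a) = 0"
    by (intro higher_pderiv_eq_0) (simp add: degree_taylor_poly)
  then show ?thesis using False by simp
qed

text \<open>At \<open>a\<close> only the derivative of order \<open>m\<close> of the kernel is
  nonzero, and its sign \<open>(-1) ^ m\<close> cancels the sign from integrating by parts. The
  boundary sum thus collapses to one entry of \<open>h\<close>.\<close>

lemma sum_taylor_poly:
  fixes h :: "nat \<Rightarrow> real"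
  assumes "m < n"
  shows "(\<Sum>j<n. (-1) ^ j * h (n - Suc j) * poly ((pderiv ^^ j) (taylor_poly m a)) a) = h (n - Suc m)"
proof -
  have "(\<Sum>j<n. (-1) ^ j * h (n - Suc j) * poly ((pderiv ^^ j) (taylor_poly m a)) a)
      = (\<Sum>j<n. if j = m then h (n - Suc m) else 0)"
    by (rule sum.cong) (auto simp: poly_higher_pderiv_taylor_poly simp flip: power_add)
  then show ?thesis using assms by simp
qed

text \<open>Pairing with the truncated power evaluates a derivative at \<open>a\<close>, so \<open>f\<^sup>(\<^sup>n\<^sup>)\<close> may equally be paired with
  the error of any polynomial approximation of that power.\<close>

definition spline_error :: "nat \<Rightarrow> real \<Rightarrow> real poly \<Rightarrow> real \<Rightarrow> real" where
  "spline_error m a p x = (if x \<le> a then poly (taylor_poly m a) x else 0) - poly p x"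

text \<open>Optimality is encoded by orthogonality: \<open>p\<close> is the projection of the
  truncated power onto the polynomials of degree below \<open>n\<close>, and \<open>V\<close> is the
  squared distance.\<close>

definition best_approx :: "nat \<Rightarrow> nat \<Rightarrow> real \<Rightarrow> real poly \<Rightarrow> real \<Rightarrow> bool" where
  "best_approx n m a p V \<longleftrightarrow> degree p < n \<and>
     (\<forall>q. degree q < n \<longrightarrow> ((\<lambda>x. spline_error m a p x * poly q x) has_integral 0) {0..1}) \<and>
     ((\<lambda>x. (spline_error m a p x)\<^sup>2) has_integral V) {0..1}"

lemma has_integral_le_subinterval:
  fixes g :: "real \<Rightarrow> real"
  assumes "(g has_integral I) {0..a}" "0 \<le> a" "a \<le> 1"
  shows "((\<lambda>x. if x \<le> a then g x else 0) has_integral I) {0..1}"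
proof -
  have "((\<lambda>x. if x \<in> {0..a} then g x else 0) has_integral I) {0..1}"
    using assms has_integral_restrict[of "{0..a}" "{0..1}" g I] by auto
  then show ?thesis by (rule has_integral_eq[rotated]) auto
qed

lemma W0_pairing_spline_error:
  assumes f: "f \<in> W0 n" and a: "0 \<le> a" "a \<le> 1" and "m < n" and deg: "degree p < n"
  shows "((\<lambda>x. deriv01 n f x * spline_error m a p x) has_integral deriv01 (n - Suc m) f a) {0..1}"
proof -
  have "((\<lambda>x. deriv01 n f x * poly (taylor_poly m a) x) has_integral deriv01 (n - Suc m) f a) {0..a}"
    using W0_pairing[OF f a, of "taylor_poly m a"] \<open>m < n\<close>
    by (simp add: degree_taylor_poly sum_taylor_poly[where h = "\<lambda>j. deriv01 j f a"])
  then have 1: "((\<lambda>x. if x \<le> a then deriv01 n f x * poly (taylor_poly m a) x else 0) has_integral deriv01 (n - Suc m) f a) {0..1}"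
    by (rule has_integral_le_subinterval[OF _ a])
  have "(\<Sum>j<n. (-1) ^ j * deriv01 (n - Suc j) f 1 * poly ((pderiv ^^ j) p) 1) = 0"
    using f by (intro sum.neutral) (auto simp: W0_def)
  then have 2: "((\<lambda>x. deriv01 n f x * poly p x) has_integral 0) {0..1}"
    using W0_pairing[OF f _ _ deg, of 1] by simp
  have "((\<lambda>x. (if x \<le> a then deriv01 n f x * poly (taylor_poly m a) x else 0) - deriv01 n f x * poly p x)
      has_integral deriv01 (n - Suc m) f a) {0..1}"
    using has_integral_diff[OF 1 2] by simp
  then show ?thesis
    by (rule has_integral_eq[rotated]) (auto simp: spline_error_def algebra_simps)
qed

text \<open>The discriminant argument behind the Cauchy-Schwarz inequality; the sign of
  \<open>V\<close> is itself extracted from the quadratic.\<close>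

lemma square_le_of_quadratic_nonneg:
  fixes d V :: real
  assumes "\<And>l. 0 \<le> 1 - 2 * l * d + l\<^sup>2 * V"
  shows "d\<^sup>2 \<le> V"
proof (cases "V = 0")
  case True
  have "d = 0"
  proof (rule ccontr)
    assume "d \<noteq> 0"
    then show False using assms[of "1 / d"] True by simp
  qed
  with True show ?thesis by simp
next
  case False
  have "V > 0"
  proof (rule ccontr)
    assume "\<not> V > 0"
    with False have V: "V < 0" by simp
    \<comment> \<open>At \<open>l\<close> and \<open>-l\<close> the quadratic takes the values
      \<open>-1 - 2 * l * d\<close> and \<open>-1 + 2 * l * d\<close>, which cannot both be
      nonnegative.\<close>
    define l where "l = sqrt (2 / - V)"
    have "l\<^sup>2 * V = -2" using V by (simp add: l_def real_sqrt_pow2)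
    then show False using assms[of l] assms[of "-l"] by simp
  qed
  then have "0 \<le> 1 - d\<^sup>2 / V" using assms[of "d / V"] by (simp add: field_simps power2_eq_square)
  then show ?thesis using \<open>V > 0\<close> by (simp add: field_simps)
qed

text \<open>Integrating the square of \<open>deriv01 n f x - l * spline_error m a p x\<close> gives
  a nonnegative quadratic in \<open>l\<close>, whose linear coefficient is the wanted derivative by
  the pairing with the error.\<close>

lemma W0_deriv_bound:
  assumes f: "f \<in> W0 n" and a: "0 \<le> a" "a \<le> 1" and "m < n"
    and norm: "(LINT x|lebesgue_on {0..1}. \<bar>deriv01 n f x\<bar>\<^sup>2) \<le> 1"
    and best: "best_approx n m a p V"
  shows "\<bar>deriv01 (n - Suc m) f a\<bar> \<le> sqrt V"
proof -
  let ?I = "LINT x|lebesgue_on {0..1}. \<bar>deriv01 n f x\<bar>\<^sup>2"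
  define d where "d = deriv01 (n - Suc m) f a"
  have 1: "((\<lambda>x. \<bar>deriv01 n f x\<bar>\<^sup>2) has_integral ?I) {0..1}"
    using f by (intro has_integral_integral_lebesgue_on) (auto simp: W0_def)
  have 2: "((\<lambda>x. deriv01 n f x * spline_error m a p x) has_integral d) {0..1}"
    unfolding d_def using best \<open>m < n\<close> by (intro W0_pairing_spline_error f a) (auto simp: best_approx_def)
  have 3: "((\<lambda>x. (spline_error m a p x)\<^sup>2) has_integral V) {0..1}"
    using best by (simp add: best_approx_def)
  have "0 \<le> 1 - 2 * l * d + l\<^sup>2 * V" for l
  proof -
    have "((\<lambda>x. \<bar>deriv01 n f x\<bar>\<^sup>2 - 2 * l * (deriv01 n f x * spline_error m a p x) + l\<^sup>2 * (spline_error m a p x)\<^sup>2)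
        has_integral ?I - 2 * l * d + l\<^sup>2 * V) {0..1}"
      by (intro has_integral_add has_integral_diff has_integral_mult_right 1 2 3)
    moreover have "0 \<le> \<bar>deriv01 n f x\<bar>\<^sup>2 - 2 * l * (deriv01 n f x * spline_error m a p x) + l\<^sup>2 * (spline_error m a p x)\<^sup>2" for x
      using zero_le_power2[of "deriv01 n f x - l * spline_error m a p x"]
      by (simp add: power2_diff power_mult_distrib mult_ac)
    ultimately have "0 \<le> ?I - 2 * l * d + l\<^sup>2 * V"
      by (rule has_integral_nonneg)
    then show ?thesis using norm by linarith
  qed
  then have "d\<^sup>2 \<le> V" by (rule square_le_of_quadratic_nonneg)
  then have "sqrt (d\<^sup>2) \<le> sqrt V" by (rule real_sqrt_le_mono)
  then show ?thesis by (simp add: d_def)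
qed

section \<open>Extremal functions\<close>

text \<open>Derivatives within a nondegenerate interval are unique, so a chain \<open>G\<close> of
  successive derivatives must agree with the iterated operator.\<close>

lemma deriv01_eqI:
  assumes G0: "\<And>x. x \<in> {0..1} \<Longrightarrow> f x = G 0 x"
    and deriv: "\<And>j x. Suc j < n \<Longrightarrow> x \<in> {0..1} \<Longrightarrow> (G j has_vector_derivative G (Suc j) x) (at x within {0..1})"
  shows "j < n \<Longrightarrow> x \<in> {0..1} \<Longrightarrow> deriv01 j f x = G j x"
proof (induction j arbitrary: x)
  case 0
  then show ?case by (simp add: deriv01_def G0)
next
  case (Suc j)
  have "(deriv01 j f has_vector_derivative G (Suc j) x) (at x within {0..1})"
    by (rule has_vector_derivative_transform[OF Suc.prems(2) _ deriv[OF Suc.prems]]) (use Suc in auto)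
  then have "vector_derivative (deriv01 j f) (at x within {0..1}) = G (Suc j) x"
    using vector_derivative_within_cbox[of 0 1 x "deriv01 j f"] Suc.prems by simp
  then show ?case by (simp add: deriv01_def)
qed

text \<open>Membership is certified by an explicit chain \<open>G\<close> of derivatives. The finite
  set \<open>S\<close> leaves room for the jump of the top derivative at the knot of a
  spline.\<close>

lemma W0I:
  assumes n: "n \<ge> 1" and S: "finite S"
    and G0: "\<And>x. x \<in> {0..1} \<Longrightarrow> f x = G 0 x"
    and deriv: "\<And>j x. Suc j < n \<Longrightarrow> x \<in> {0..1} \<Longrightarrow> (G j has_vector_derivative G (Suc j) x) (at x within {0..1})"
    and derivn: "\<And>x. x \<in> {0..1} - S \<Longrightarrow> (G (n - 1) has_vector_derivative G n x) (at x within {0..1})"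
    and ac: "\<And>j. j < n \<Longrightarrow> abs_cont_on 0 1 (G j)"
    and bd: "\<And>j. j < n \<Longrightarrow> G j 0 = 0 \<and> G j 1 = 0"
    and sq: "((\<lambda>x. (G n x)\<^sup>2) has_integral I) {0..1}"
  shows "f \<in> W0 n" and "(LINT x|lebesgue_on {0..1}. \<bar>deriv01 n f x\<bar>\<^sup>2) = I"
    and "x \<in> {0..1} - S \<Longrightarrow> deriv01 n f x = G n x"
proof -
  have eq: "deriv01 j f x = G j x" if "j < n" "x \<in> {0..1}" for j x
    by (rule deriv01_eqI[of f G n, OF G0 deriv that]) 
  have deriv_f: "(deriv01 j f has_vector_derivative G (Suc j) x) (at x within {0..1})"
    if "Suc j < n" "x \<in> {0..1}" for j x
    by (rule has_vector_derivative_transform[OF that(2) _ deriv[OF that]]) (use that eq in auto)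
  have derivn_f: "(deriv01 (n - 1) f has_vector_derivative G n x) (at x within {0..1})"
    if "x \<in> {0..1} - S" for x
  proof (rule has_vector_derivative_transform[OF _ _ derivn[OF that]])
    show "x \<in> {0..1}" using that by blast
    show "deriv01 (n - 1) f y = G (n - 1) y" if "y \<in> {0..1}" for y
      using eq[of "n - 1" y] n that by simp
  qed
  have eqn: "deriv01 n f x = G n x" if "x \<in> {0..1} - S" for x
  proof -
    have "vector_derivative (deriv01 (n - 1) f) (at x within {0..1}) = G n x"
      using vector_derivative_within_cbox[of 0 1 x "deriv01 (n - 1) f"] derivn_f[OF that] that by simp
    moreover have "deriv01 n f x = deriv01 (Suc (n - 1)) f x" using n by simp
    ultimately show ?thesis by (simp add: deriv01_def)
  qed
  have ac_f: "abs_cont_on 0 1 (deriv01 j f)" if "j < n" for j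
    unfolding abs_cont_on_def
  proof (intro allI impI)
    fix e :: real assume "e > 0"
    from ac[OF that, unfolded abs_cont_on_def, rule_format, OF this] obtain d where d: "d > 0"
      "\<forall>(m::nat) u v. (\<forall>i<m. 0 \<le> u i \<and> u i \<le> v i \<and> v i \<le> 1) \<and>
        (\<forall>i<m. \<forall>j<m. i \<noteq> j \<longrightarrow> {u i<..<v i} \<inter> {u j<..<v j} = {}) \<and>
        (\<Sum>i<m. v i - u i) < d \<longrightarrow> (\<Sum>i<m. \<bar>G j (v i) - G j (u i)\<bar>) < e" by (elim exE conjE)
    show "\<exists>d>0. \<forall>(m::nat) u v. (\<forall>i<m. 0 \<le> u i \<and> u i \<le> v i \<and> v i \<le> 1) \<and>
        (\<forall>i<m. \<forall>j<m. i \<noteq> j \<longrightarrow> {u i<..<v i} \<inter> {u j<..<v j} = {}) \<and>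
        (\<Sum>i<m. v i - u i) < d \<longrightarrow> (\<Sum>i<m. \<bar>deriv01 j f (v i) - deriv01 j f (u i)\<bar>) < e"
    proof (intro exI[where x = d] conjI allI impI)
      fix m :: nat and u v :: "nat \<Rightarrow> real"
      assume *: "(\<forall>i<m. 0 \<le> u i \<and> u i \<le> v i \<and> v i \<le> 1) \<and>
        (\<forall>i<m. \<forall>j<m. i \<noteq> j \<longrightarrow> {u i<..<v i} \<inter> {u j<..<v j} = {}) \<and> (\<Sum>i<m. v i - u i) < d"
      have "u i \<in> {0..1} \<and> v i \<in> {0..1}" if "i < m" for i
        using *[THEN conjunct1, rule_format, OF that] by auto
      then have "(\<Sum>i<m. \<bar>deriv01 j f (v i) - deriv01 j f (u i)\<bar>) = (\<Sum>i<m. \<bar>G j (v i) - G j (u i)\<bar>)"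
        using eq[OF \<open>j < n\<close>] by (intro sum.cong) auto
      then show "(\<Sum>i<m. \<bar>deriv01 j f (v i) - deriv01 j f (u i)\<bar>) < e"
        using d(2)[rule_format, OF *] by simp
    qed (rule d(1))
  qed
  have "negligible S" using S by (rule negligible_finite)
  \<comment> \<open>Measurability is obtained from integrability of the derivative of an absolutely
    continuous function; this covers the unspecified values on \<open>S\<close> as well.\<close>
  have "(deriv01 n f has_integral deriv01 (n - 1) f 1 - deriv01 (n - 1) f 0) {0..1}"
  proof (rule has_integral_abs_cont_on[OF _ ac_f \<open>negligible S\<close>])
    fix x :: real assume x: "x \<in> {0..1} - S"
    show "(deriv01 (n - 1) f has_vector_derivative deriv01 n f x) (at x within {0..1})"
      using derivn_f[OF x] eqn[OF x] by simp
  qed (use n in auto)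
  then have meas: "deriv01 n f \<in> borel_measurable (lebesgue_on {0..1})"
    by (intro integrable_imp_measurable) (auto simp: integrable_on_def)
  have sq_f: "((\<lambda>x. \<bar>deriv01 n f x\<bar>\<^sup>2) has_integral I) {0..1}"
    by (rule has_integral_spike[OF \<open>negligible S\<close> _ sq]) (use eqn in auto)
  have "(\<lambda>x. \<bar>deriv01 n f x\<bar>\<^sup>2) absolutely_integrable_on {0..1}"
    using sq_f by (intro nonnegative_absolutely_integrable_1) (auto simp: integrable_on_def)
  then have int: "integrable (lebesgue_on {0..1}) (\<lambda>x. \<bar>deriv01 n f x\<bar>\<^sup>2)"
    by (simp add: absolutely_integrable_on_def set_integrable_def integrable_restrict_space)
  have "AE x in lebesgue_on {0..1}. deriv01 (n - 1) f differentiable (at x within {0..1})"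
  proof -
    have "AE x in lebesgue. x \<notin> S"
      using \<open>negligible S\<close> by (simp add: negligible_iff_null_sets AE_not_in)
    then show ?thesis
      using derivn_f by (auto simp: AE_restrict_space_iff elim!: eventually_mono intro: differentiableI_vector)
  qed
  moreover have "deriv01 j f differentiable (at x within {0..1})" if "j + 1 < n" "x \<in> {0..1}" for j x
    using deriv_f[of j x] that by (auto intro: differentiableI_vector)
  ultimately show "f \<in> W0 n"
    using ac_f meas int eq bd by (simp add: W0_def)
  show "(LINT x|lebesgue_on {0..1}. \<bar>deriv01 n f x\<bar>\<^sup>2) = I"
    using lebesgue_integral_eq_integral[OF int] sq_f by (simp add: integral_unique)
  show "x \<in> {0..1} - S \<Longrightarrow> deriv01 n f x = G n x" by (rule eqn)
qed

lemma poly_primitive_exists: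
  fixes p :: "real poly"
  shows "\<exists>P. (pderiv ^^ n) P = p \<and> (\<forall>j<n. poly ((pderiv ^^ j) P) 0 = 0)"
proof (induction n arbitrary: p)
  case (Suc n)
  define Q where "Q = (\<Sum>i\<le>degree p. monom (coeff p i / real (Suc i)) (Suc i))"
  have "pderiv Q = (\<Sum>i\<le>degree p. monom (coeff p i) i)"
    unfolding Q_def by (simp add: higher_pderiv_sum[of 1, simplified] pderiv_monom del: of_nat_Suc)
  then have "pderiv Q = p" by (simp add: poly_as_sum_of_monoms)
  moreover have "poly Q 0 = 0" by (simp add: Q_def poly_sum poly_monom)
  moreover from Suc.IH[of Q] obtain P where "(pderiv ^^ n) P = Q" "\<forall>j<n. poly ((pderiv ^^ j) P) 0 = 0"
    by (elim exE conjE)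
  ultimately show ?case by (intro exI[of _ P]) (auto simp: less_Suc_eq)
qed simp

text \<open>The factorial makes differentiation lower \<open>e\<close> by one. The value 0 at the
  knot, also for \<open>e = 0\<close>, matches the convention of \<open>spline_error\<close> at
  \<open>a\<close>.\<close>

definition pos_power :: "nat \<Rightarrow> real \<Rightarrow> real \<Rightarrow> real" where
  "pos_power e a x = (if x \<le> a then 0 else (x - a) ^ e / fact e)"

lemma abs_cont_on_pos_power: "abs_cont_on 0 1 (pos_power (Suc e) a)"
proof -
  have "pos_power (Suc e) a = (\<lambda>x. max 0 (x - a) ^ Suc e * (1 / fact (Suc e)))"
    by (auto simp: pos_power_def max_def)
  then show ?thesis
    by (simp only: abs_cont_on_mult abs_cont_on_power abs_cont_on_pos_part abs_cont_on_const)
qed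

lemma has_derivative_pos_power:
  assumes "e \<ge> 1 \<or> x \<noteq> a"
  shows "(pos_power (Suc e) a has_real_derivative pos_power e a x) (at x)"
proof -
  consider "x < a" | "x > a" | "x = a" "e \<ge> 1" using assms by linarith
  then show ?thesis
  proof cases
    case 1
    have "((\<lambda>x. 0) has_real_derivative pos_power e a x) (at x)" using 1 by (simp add: pos_power_def)
    then show ?thesis
      by (rule has_field_derivative_transform_within_open[where S = "{..<a}"]) (use 1 in \<open>auto simp: pos_power_def\<close>)
  next
    case 2
    have "((\<lambda>x. (x - a) ^ Suc e / fact (Suc e)) has_real_derivative real (Suc e) * (x - a) ^ e / fact (Suc e)) (at x)"
      by (auto intro!: derivative_eq_intros simp del: of_nat_Suc fact_Suc power_Suc)
    also have "real (Suc e) * (x - a) ^ e / fact (Suc e) = pos_power e a x"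
      using 2 by (simp add: pos_power_def del: of_nat_Suc)
    finally have "((\<lambda>x. (x - a) ^ Suc e / fact (Suc e)) has_real_derivative pos_power e a x) (at x)" .
    then show ?thesis
      by (rule has_field_derivative_transform_within_open[where S = "{a<..}"]) (use 2 in \<open>auto simp: pos_power_def\<close>)
  next
    case 3
    \<comment> \<open>Caratheodory's criterion at the knot: \<open>?g\<close> is the slope function,
      continuous and zero at \<open>a\<close> because \<open>e\<close> is at least 1.\<close>
    let ?g = "\<lambda>x. max 0 (x - a) ^ e / fact (Suc e)"
    have "\<forall>z. pos_power (Suc e) a z - pos_power (Suc e) a a = ?g z * (z - a)"
      using 3 by (auto simp: pos_power_def max_def)
    moreover have "isCont ?g a" by (intro continuous_intros) auto
    moreover have "?g a = 0" using 3 by simp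
    ultimately have "(pos_power (Suc e) a has_real_derivative 0) (at a)"
      unfolding CARAT_DERIV by (intro exI[of _ ?g] conjI)
    then show ?thesis using 3 by (simp add: pos_power_def)
  qed
qed

text \<open>The extremal function is the \<open>n\<close>-fold primitive of the normalised approximation error; its
  boundary values at 1 vanish because the error is orthogonal to polynomials.\<close>

lemma W0_extremal:
  assumes n: "m < n" and a: "0 \<le> a" "a \<le> 1" and best: "best_approx n m a p V"
  shows "\<exists>f\<in>W0 n. (LINT x|lebesgue_on {0..1}. \<bar>deriv01 n f x\<bar>\<^sup>2) \<le> 1 \<and> deriv01 (n - Suc m) f a = sqrt V"
proof -
  from poly_primitive_exists[of n "taylor_poly m a - p"] obtain P where
    P: "(pderiv ^^ n) P = taylor_poly m a - p" and P0: "\<forall>j<n. poly ((pderiv ^^ j) P) 0 = 0"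
    by (elim exE conjE)
  \<comment> \<open>Scales the error to unit norm. If \<open>V = 0\<close>, division by zero gives
    \<open>w = 0\<close>, and the zero function attains the bound.\<close>
  define w where "w = 1 / sqrt V"
  define G where "G j x = (if j < n then w * (poly ((pderiv ^^ j) P) x + (- ((-1) ^ m)) * pos_power (m + n - j) a x)
    else w * spline_error m a p x)" for j x
  have V: "((\<lambda>x. (spline_error m a p x)\<^sup>2) has_integral V) {0..1}"
    and orth: "\<And>q. degree q < n \<Longrightarrow> ((\<lambda>x. spline_error m a p x * poly q x) has_integral 0) {0..1}"
    and deg: "degree p < n"
    using best by (auto simp: best_approx_def)
  have "V \<ge> 0" using V by (rule has_integral_nonneg) simp
  \<comment> \<open>The truncated power is the full Taylor kernel minus its part to the right of
    \<open>a\<close>. In this form its primitives are a polynomial plus a multiple of a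
    \<open>pos_power\<close>.\<close>
  have error: "spline_error m a p x = poly ((pderiv ^^ n) P) x + (- ((-1) ^ m)) * pos_power m a x" for x
  proof -
    have "(a - x) ^ m = (-1) ^ m * (x - a) ^ m" by (simp flip: power_mult_distrib)
    then show ?thesis by (simp add: P spline_error_def pos_power_def poly_taylor_poly)
  qed
  have D: "(G j has_vector_derivative G (Suc j) x) (at x within {0..1})"
    if "j < n" "Suc j < n \<or> x \<noteq> a" for j x
  proof -
    have e: "m + n - j = Suc (m + n - Suc j)" using that by simp
    have "(pos_power (m + n - j) a has_real_derivative pos_power (m + n - Suc j) a x) (at x)"
      unfolding e using that by (intro has_derivative_pos_power) auto
    moreover have "(poly ((pderiv ^^ j) P) has_real_derivative poly ((pderiv ^^ Suc j) P) x) (at x)"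
      using poly_DERIV[of "(pderiv ^^ j) P" x] by simp
    ultimately have "((\<lambda>x. w * (poly ((pderiv ^^ j) P) x + (- ((-1) ^ m)) * pos_power (m + n - j) a x)) has_real_derivative
        w * (poly ((pderiv ^^ Suc j) P) x + (- ((-1) ^ m)) * pos_power (m + n - Suc j) a x)) (at x)"
      by (intro DERIV_cmult DERIV_add)
    moreover have "G (Suc j) x = w * (poly ((pderiv ^^ Suc j) P) x + (- ((-1) ^ m)) * pos_power (m + n - Suc j) a x)"
    proof (cases "Suc j < n")
      case False
      then have "Suc j = n" using that by simp
      then show ?thesis using error[of x] by (simp add: G_def del: funpow.simps)
    qed (simp add: G_def)
    moreover have "G j = (\<lambda>x. w * (poly ((pderiv ^^ j) P) x + (- ((-1) ^ m)) * pos_power (m + n - j) a x))"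
      using that by (auto simp: G_def)
    ultimately show ?thesis
      by (metis has_field_derivative_at_within has_real_derivative_iff_has_vector_derivative)
  qed
  have ac: "abs_cont_on 0 1 (G j)" if "j < n" for j
  proof -
    have e: "m + n - j = Suc (m + n - Suc j)" using that by simp
    have "G j = (\<lambda>x. w * (poly ((pderiv ^^ j) P) x + (- ((-1) ^ m)) * pos_power (Suc (m + n - Suc j)) a x))"
      using that e by (auto simp: G_def)
    then show ?thesis
      by (simp only: abs_cont_on_mult abs_cont_on_add abs_cont_on_poly abs_cont_on_pos_power abs_cont_on_const)
  qed
  have G0: "G j 0 = 0" if "j < n" for j
    using P0 that a by (simp add: G_def pos_power_def)
  have G1: "G j 1 = 0" if "j < n" for j
  proof -
    \<comment> \<open>This kernel singles out \<open>G j 1\<close> in the boundary sum at 1, and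
      orthogonality of the error to \<open>q\<close> forces it to be 0.\<close>
    define q where "q = taylor_poly (n - Suc j) 1"
    have q: "degree q < n" using that by (simp add: q_def degree_taylor_poly)
    have "((\<lambda>x. G n x * poly q x) has_integral
      (\<Sum>j<n. (-1) ^ j * G (n - Suc j) 1 * poly ((pderiv ^^ j) q) 1)
      - (\<Sum>j<n. (-1) ^ j * G (n - Suc j) 0 * poly ((pderiv ^^ j) q) 0)) {0..1}"
      by (rule has_integral_iterated_by_parts[where S = "{a}" and F = G and n = n and q = q and a = 0 and b = 1])
         (auto intro: ac D q)
    moreover have "(\<Sum>j<n. (-1) ^ j * G (n - Suc j) 0 * poly ((pderiv ^^ j) q) 0) = 0"
      using G0 by (intro sum.neutral) auto
    moreover have "(\<Sum>j<n. (-1) ^ j * G (n - Suc j) 1 * poly ((pderiv ^^ j) q) 1) = G j 1"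
      using sum_taylor_poly[of "n - Suc j" n "\<lambda>j. G j 1" 1] that by (simp add: q_def)
    ultimately have "((\<lambda>x. G n x * poly q x) has_integral G j 1) {0..1}" by simp
    moreover have "((\<lambda>x. G n x * poly q x) has_integral 0) {0..1}"
      using has_integral_mult_right[OF orth[OF q], of w] by (simp add: G_def mult.assoc)
    ultimately show ?thesis by (rule has_integral_unique)
  qed
  have norm: "((\<lambda>x. (G n x)\<^sup>2) has_integral w\<^sup>2 * V) {0..1}"
    using has_integral_mult_right[OF V, of "w\<^sup>2"] by (simp add: G_def power_mult_distrib)
  have W: "G 0 \<in> W0 n" and I: "(LINT x|lebesgue_on {0..1}. \<bar>deriv01 n (G 0) x\<bar>\<^sup>2) = w\<^sup>2 * V"
    and Gn: "\<And>x. x \<in> {0..1} - {a} \<Longrightarrow> deriv01 n (G 0) x = G n x"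
  proof -
    have 1: "n \<ge> 1" using n by simp
    have Dn: "(G (n - 1) has_vector_derivative G n x) (at x within {0..1})" if "x \<in> {0..1} - {a}" for x
      using D[of "n - 1" x] that 1 by simp
    note * = W0I[where S = "{a}" and G = G and f = "G 0", OF 1 _ _ D Dn ac _ norm]
    show "G 0 \<in> W0 n" "(LINT x|lebesgue_on {0..1}. \<bar>deriv01 n (G 0) x\<bar>\<^sup>2) = w\<^sup>2 * V"
      by (rule *; use G0 G1 in simp)+
    show "deriv01 n (G 0) x = G n x" if "x \<in> {0..1} - {a}" for x
      by (rule *(3)[OF _ _ _ _ _ _ _ that]; use G0 G1 in simp)
  qed
  have "w\<^sup>2 * V \<le> 1" using \<open>V \<ge> 0\<close> by (simp add: w_def power_divide)
  moreover have "deriv01 (n - Suc m) (G 0) a = sqrt V"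
  proof -
    \<comment> \<open>Evaluating at \<open>a\<close> means pairing the top derivative, which is
      \<open>w\<close> times the error, with the error itself; the result is
      \<open>w * V\<close>.\<close>
    have 1: "((\<lambda>x. deriv01 n (G 0) x * spline_error m a p x) has_integral deriv01 (n - Suc m) (G 0) a) {0..1}"
      by (rule W0_pairing_spline_error[OF W a n deg])
    have "((\<lambda>x. w * (spline_error m a p x)\<^sup>2) has_integral deriv01 (n - Suc m) (G 0) a) {0..1}"
      by (intro has_integral_spike[OF negligible_sing[of a] _ 1]) (auto simp: Gn G_def power2_eq_square)
    moreover have "((\<lambda>x. w * (spline_error m a p x)\<^sup>2) has_integral w * V) {0..1}"
      by (rule has_integral_mult_right[OF V])
    ultimately have "deriv01 (n - Suc m) (G 0) a = w * V" by (rule has_integral_unique)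
    also have "w * V = sqrt V" using \<open>V \<ge> 0\<close> by (simp add: w_def real_div_sqrt)
    finally show ?thesis .
  qed
  ultimately show ?thesis using W I by (intro bexI[of _ "G 0"]) auto
qed

theorem A_eq_sqrt:
  assumes "m < n" and "0 \<le> a" "a \<le> 1" and "best_approx n m a p V"
  shows "A n (n - Suc m) a = ereal (sqrt V)"
proof (rule antisym)
  show "A n (n - Suc m) a \<le> ereal (sqrt V)"
    unfolding A_def using W0_deriv_bound[OF _ assms(2,3,1) _ assms(4)] by (intro SUP_least) auto
  from W0_extremal[OF assms] obtain f where f: "f \<in> W0 n"
    "(LINT x|lebesgue_on {0..1}. \<bar>deriv01 n f x\<bar>\<^sup>2) \<le> 1" "deriv01 (n - Suc m) f a = sqrt V" by (elim bexE conjE)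
  have "V \<ge> 0"
    using assms(4) unfolding best_approx_def by (meson has_integral_nonneg zero_le_power2)
  then have "ereal (sqrt V) = ereal \<bar>deriv01 (n - Suc m) f a\<bar>" using f(3) by simp
  also have "\<dots> \<le> A n (n - Suc m) a"
    unfolding A_def using f(1,2) by (intro SUP_upper) simp
  finally show "ereal (sqrt V) \<le> A n (n - Suc m) a" .
qed

section \<open>Best approximation of truncated powers\<close>

text \<open>Each differentiation costs at most one factor of a multiple root; truncated subtraction
  makes the claim trivial once \<open>j\<close> reaches \<open>k\<close>.\<close>

lemma linear_power_dvd_higher_pderiv:
  fixes p :: "real poly"
  assumes "[:-c, 1:] ^ k dvd p"
  shows "[:-c, 1:] ^ (k - j) dvd (pderiv ^^ j) p"
proof (induction j)
  case (Suc j)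
  show ?case
  proof (cases "k - j")
    case (Suc i)
    from Suc.IH obtain r where r: "(pderiv ^^ j) p = [:-c, 1:] ^ Suc i * r"
      unfolding Suc by (elim dvdE)
    have "pderiv ([:-c, 1:] ^ Suc i * r) = [:-c, 1:] ^ i * ([:-c, 1:] * pderiv r + smult (real (Suc i)) r)"
      unfolding pderiv_mult pderiv_power_Suc by (simp add: pderiv_pCons algebra_simps del: of_nat_Suc)
    moreover have "k - Suc j = i" using Suc by simp
    ultimately show ?thesis using r by simp
  qed simp
qed (use assms in simp)

lemma poly_higher_pderiv_eq_0:
  fixes p :: "real poly"
  assumes "[:-c, 1:] ^ k dvd p" "j < k"
  shows "poly ((pderiv ^^ j) p) c = 0"
proof -
  have "[:-c, 1:] dvd [:-c, 1:] ^ (k - j)" using assms(2) by (simp add: dvd_power)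
  then have "[:-c, 1:] dvd (pderiv ^^ j) p"
    using linear_power_dvd_higher_pderiv[OF assms(1)] dvd_trans by blast
  then show ?thesis by (simp add: poly_eq_0_iff_dvd)
qed

text \<open>Up to a constant, \<open>x ^ m\<close> is the derivative of order \<open>m + 1\<close>
  of \<open>x ^ (2 * m + 1)\<close>, and pairing with the Taylor kernel at 1 evaluates that power at
  1.\<close>

lemma has_integral_beta: "((\<lambda>x::real. (x * (1 - x)) ^ m) has_integral (fact m)\<^sup>2 / fact (2 * m + 1)) {0..1}"
proof -
  let ?P = "taylor_poly (2 * m + 1) 0" and ?q = "taylor_poly m 1"
  have d: "(pderiv ^^ Suc m) ?P = smult ((-1) ^ Suc m) (taylor_poly m 0)"
    by (subst higher_pderiv_taylor_poly) (simp_all del: funpow.simps add: mult_2)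
  have "((\<lambda>x. poly ((pderiv ^^ Suc m) ?P) x * poly ?q x) has_integral
    (\<Sum>j<Suc m. (-1) ^ j * poly ((pderiv ^^ (Suc m - Suc j)) ?P) 1 * poly ((pderiv ^^ j) ?q) 1)
    - (\<Sum>j<Suc m. (-1) ^ j * poly ((pderiv ^^ (Suc m - Suc j)) ?P) 0 * poly ((pderiv ^^ j) ?q) 0)) {0..1}"
    by (rule has_integral_poly_by_parts) (simp_all add: degree_taylor_poly)
  moreover have "(\<Sum>j<Suc m. (-1) ^ j * poly ((pderiv ^^ (Suc m - Suc j)) ?P) 1 * poly ((pderiv ^^ j) ?q) 1) = poly ?P 1"
    using sum_taylor_poly[of m "Suc m" "\<lambda>j. poly ((pderiv ^^ j) ?P) 1" 1] by simp
  moreover have "(\<Sum>j<Suc m. (-1) ^ j * poly ((pderiv ^^ (Suc m - Suc j)) ?P) 0 * poly ((pderiv ^^ j) ?q) 0) = 0"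
    by (intro sum.neutral) (auto simp: poly_higher_pderiv_taylor_poly)
  ultimately have "((\<lambda>x. poly ((pderiv ^^ Suc m) ?P) x * poly ?q x) has_integral poly ?P 1) {0..1}" by simp
  from has_integral_mult_right[OF this, of "- (fact m)\<^sup>2"]
  have "((\<lambda>x. - (fact m)\<^sup>2 * (poly ((pderiv ^^ Suc m) ?P) x * poly ?q x)) has_integral (fact m)\<^sup>2 / fact (2 * m + 1)) {0..1}"
    by (simp add: poly_taylor_poly del: funpow.simps fact_Suc)
  moreover have "- (fact m)\<^sup>2 * (poly ((pderiv ^^ Suc m) ?P) x * poly ?q x) = (x * (1 - x)) ^ m" for x
  proof -
    have "(-1) ^ Suc m * (- x) ^ m = - (x ^ m)" by (simp flip: power_mult_distrib)
    then have "poly ((pderiv ^^ Suc m) ?P) x = - (x ^ m) / fact m"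
      unfolding d by (simp add: poly_taylor_poly)
    then show ?thesis by (simp add: poly_taylor_poly power_mult_distrib power2_eq_square del: funpow.simps)
  qed
  ultimately show ?thesis by simp
qed

text \<open>The polynomial \<open>\<integral>\<^sub>0\<^sup>U (s (s + D))\<^sup>m ds\<close> of Boggio's formula for the Green function.\<close>

definition boggio :: "nat \<Rightarrow> real \<Rightarrow> real \<Rightarrow> real" where
  "boggio m U D = (\<Sum>j\<le>m. real (m choose j) / real (m + 1 + j) * (D ^ (m - j) * U ^ (m + 1 + j)))"

lemma boggio_deriv:
  fixes u d :: real
  shows "((\<lambda>u. boggio m u d) has_real_derivative (u * (u + d)) ^ m) (at u)"
proof -
  have "((\<lambda>u. boggio m u d) has_real_derivative (\<Sum>j\<le>m. real (m choose j) * (d ^ (m - j) * u ^ (m + j)))) (at u)"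
    unfolding boggio_def
  proof (rule DERIV_sum)
    fix j assume "j \<in> {..m}"
    have "((\<lambda>u. u ^ (m + 1 + j)) has_real_derivative real (m + 1 + j) * u ^ (m + j)) (at u)"
      using DERIV_pow[of "m + 1 + j" u] by simp
    from DERIV_cmult[OF DERIV_cmult[OF this], of "real (m choose j) / real (m + 1 + j)" "d ^ (m - j)"]
    show "((\<lambda>u. real (m choose j) / real (m + 1 + j) * (d ^ (m - j) * u ^ (m + 1 + j))) has_real_derivative
        real (m choose j) * (d ^ (m - j) * u ^ (m + j))) (at u)"
      by (rule DERIV_cong) (simp add: field_simps del: of_nat_add)
  qed
  also have "(\<Sum>j\<le>m. real (m choose j) * (d ^ (m - j) * u ^ (m + j))) = u ^ m * (u + d) ^ m"
    unfolding binomial_ring sum_distrib_left by (rule sum.cong) (simp_all add: power_add mult_ac)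
  finally show ?thesis by (simp add: power_mult_distrib)
qed

lemma boggio_0 [simp]: "boggio m 0 d = (0 :: real)"
  by (simp add: boggio_def)

lemma boggio_scale: "boggio m (c * u) (c * d) = c ^ (2 * m + 1) * (boggio m u d :: real)"
  unfolding boggio_def sum_distrib_left
proof (rule sum.cong)
  fix j assume "j \<in> {..m}"
  then have "2 * m + 1 = (m - j) + (m + 1 + j)" by simp
  then have "c ^ (2 * m + 1) = c ^ (m - j) * c ^ (m + 1 + j)" by (metis power_add)
  then show "real (m choose j) / real (m + 1 + j) * ((c * d) ^ (m - j) * (c * u) ^ (m + 1 + j)) =
    c ^ (2 * m + 1) * (real (m choose j) / real (m + 1 + j) * (d ^ (m - j) * u ^ (m + 1 + j)))"
    by (simp add: power_mult_distrib del: power_Suc)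
qed simp

lemma boggio_1: "boggio m 1 (-1) = (-1) ^ m * (fact m)\<^sup>2 / (fact (2 * m + 1) :: real)"
proof -
  have "((\<lambda>u. (u * (u + -1)) ^ m) has_integral boggio m 1 (-1) - boggio m 0 (-1 :: real)) {0..1}"
    using boggio_deriv[of m "-1"]
    by (intro fundamental_theorem_of_calculus) (auto intro: has_field_derivative_at_within simp flip: has_real_derivative_iff_has_vector_derivative)
  moreover have "(u * (u + -1)) ^ m = (-1) ^ m * (u * (1 - u)) ^ m" for u :: real
    by (simp add: algebra_simps flip: power_mult_distrib)
  ultimately have "((\<lambda>u::real. (-1) ^ m * (u * (1 - u)) ^ m) has_integral boggio m 1 (-1)) {0..1}" by simp
  with has_integral_mult_right[OF has_integral_beta[of m], of "(-1) ^ m"] show ?thesis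
    by (auto dest: has_integral_unique)
qed

text \<open>As functions of \<open>u\<close> both instances of \<open>boggio\<close> have derivative
  \<open>(u * (u + d)) ^ m\<close>, so they differ by a constant, which homogeneity at
  \<open>u = 0\<close> reduces to \<open>boggio m 1 (-1)\<close>. This difference glues the two
  branches of the Green function.\<close>

lemma boggio_reflect:
  fixes u d :: real
  shows "boggio m (u + d) (- d) = boggio m u d + (-1) ^ m * (fact m)\<^sup>2 / fact (2 * m + 1) * d ^ (2 * m + 1)"
proof -
  let ?g = "\<lambda>u. boggio m (u + d) (- d) - boggio m u d"
  have "(?g has_real_derivative 0) (at u)" for u
  proof -
    have "((\<lambda>u. boggio m (u + d) (- d)) has_real_derivative ((u + d) * (u + d + - d)) ^ m) (at u)"
      using boggio_deriv[of m "- d" "u + d"] by (simp only: DERIV_shift)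
    from DERIV_diff[OF this boggio_deriv[of m d u]] show ?thesis by (simp add: mult.commute)
  qed
  then have "?g u = ?g 0" by (intro DERIV_isconst_all allI)
  also have "?g 0 = boggio m (d * 1) (d * (-1))" by simp
  also have "\<dots> = d ^ (2 * m + 1) * boggio m 1 (-1)" by (rule boggio_scale)
  finally show ?thesis by (simp add: boggio_1 algebra_simps)
qed

definition boggio_poly :: "nat \<Rightarrow> real poly \<Rightarrow> real poly \<Rightarrow> real poly" where
  "boggio_poly m U D = (\<Sum>j\<le>m. smult (real (m choose j) / real (m + 1 + j)) (D ^ (m - j) * U ^ (m + 1 + j)))"

lemma poly_boggio_poly: "poly (boggio_poly m U D) x = boggio m (poly U x) (poly D x)"
  by (simp add: boggio_poly_def boggio_def poly_sum)

text \<open>Every summand contains \<open>U\<close> at least \<open>m + 1\<close> times. This gives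
  the Green function its zero of order \<open>m + 1\<close> at each endpoint.\<close>

lemma power_dvd_boggio_poly:
  assumes "p dvd U"
  shows "p ^ Suc m dvd boggio_poly m U D"
  unfolding boggio_poly_def
proof (rule dvd_sum)
  fix j assume "j \<in> {..m}"
  have "p ^ Suc m dvd p ^ (m + 1 + j)" by (rule le_imp_power_dvd) simp
  also have "\<dots> dvd U ^ (m + 1 + j)" by (rule dvd_power_same[OF assms])
  finally show "p ^ Suc m dvd smult (real (m choose j) / real (m + 1 + j)) (D ^ (m - j) * U ^ (m + 1 + j))"
    by (intro dvd_smult dvd_mult)
qed

lemma degree_boggio_poly:
  assumes "degree U \<le> 1" "degree D \<le> 1"
  shows "degree (boggio_poly m U D) \<le> 2 * m + 1"
  unfolding boggio_poly_def
proof (rule degree_sum_le)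
  fix j assume j: "j \<in> {..m}"
  have "degree (D ^ (m - j) * U ^ (m + 1 + j)) \<le> degree (D ^ (m - j)) + degree (U ^ (m + 1 + j))"
    by (rule degree_mult_le)
  also have "\<dots> \<le> degree D * (m - j) + degree U * (m + 1 + j)"
    by (intro add_mono degree_power_le)
  also have "\<dots> \<le> 1 * (m - j) + 1 * (m + 1 + j)"
    using assms by (intro add_mono mult_right_mono) auto
  also have "\<dots> = 2 * m + 1" using j by simp
  finally show "degree (smult (real (m choose j) / real (m + 1 + j)) (D ^ (m - j) * U ^ (m + 1 + j))) \<le> 2 * m + 1"
    by (rule order_trans[OF degree_smult_le])
qed simp

lemma has_integral_poly_by_parts_left:
  fixes p q :: "real poly"
  assumes "0 \<le> a" "degree q < n" "[:0, 1:] ^ n dvd p"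
  shows "((\<lambda>x. poly ((pderiv ^^ n) p) x * poly q x) has_integral
    (\<Sum>j<n. (-1) ^ j * poly ((pderiv ^^ (n - Suc j)) p) a * poly ((pderiv ^^ j) q) a)) {0..a}"
proof -
  have "(\<Sum>j<n. (-1) ^ j * poly ((pderiv ^^ (n - Suc j)) p) 0 * poly ((pderiv ^^ j) q) 0) = 0"
    using poly_higher_pderiv_eq_0[of 0 n p] assms(3) by (intro sum.neutral) auto
  with has_integral_poly_by_parts[OF assms(1,2), of p] show ?thesis by simp
qed

lemma has_integral_poly_by_parts_right:
  fixes p q :: "real poly"
  assumes "a \<le> 1" "degree q < n" "[:-1, 1:] ^ n dvd p"
  shows "((\<lambda>x. poly ((pderiv ^^ n) p) x * poly q x) has_integral
    - (\<Sum>j<n. (-1) ^ j * poly ((pderiv ^^ (n - Suc j)) p) a * poly ((pderiv ^^ j) q) a)) {a..1}"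
proof -
  have "(\<Sum>j<n. (-1) ^ j * poly ((pderiv ^^ (n - Suc j)) p) 1 * poly ((pderiv ^^ j) q) 1) = 0"
    using poly_higher_pderiv_eq_0[of 1 n p] assms(3) by (intro sum.neutral) auto
  with has_integral_poly_by_parts[OF assms(1,2), of p] show ?thesis by simp
qed

lemma has_integral_piecewise:
  fixes g h :: "real \<Rightarrow> real"
  assumes "(g has_integral I) {0..a}" "(h has_integral J) {a..1}" "0 \<le> a" "a \<le> 1"
  shows "((\<lambda>x. if x \<le> a then g x else h x) has_integral I + J) {0..1}"
proof (rule has_integral_combine[OF assms(3,4)])
  show "((\<lambda>x. if x \<le> a then g x else h x) has_integral I) {0..a}"
    using assms(1) by (rule has_integral_eq[rotated]) auto
  show "((\<lambda>x. if x \<le> a then g x else h x) has_integral J) {a..1}"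
    by (rule has_integral_spike[OF negligible_sing[of a] _ assms(2)]) auto
qed

text \<open>The residual of the best approximation by polynomials of degree at most \<open>m\<close> is the derivative
  of order \<open>m + 1\<close> of Boggio's Green function.\<close>

lemma best_approx_base:
  assumes a: "0 \<le> a" "a \<le> 1"
  shows "\<exists>p. best_approx (Suc m) m a p ((a * (1 - a)) ^ (2 * m + 1) / (real (2 * m + 1) * (fact m)\<^sup>2))"
proof -
  let ?n = "Suc m"
  \<comment> \<open>The branches of the Green function with pole \<open>a\<close>: \<open>L\<close>,
    used left of \<open>a\<close>, has upper limit \<open>x * (1 - a)\<close> and shift
    \<open>a - x\<close>; \<open>R\<close>, used to the right, has \<open>a * (1 - x)\<close> and
    \<open>x - a\<close>.\<close>
  define L where "L = smult (1 / (fact m)\<^sup>2) (boggio_poly m [:0, 1 - a:] [:a, -1:])"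
  define R where "R = smult (1 / (fact m)\<^sup>2) (boggio_poly m [:a, -a:] [:-a, 1:])"
  \<comment> \<open>Because \<open>x * (1 - a) = a * (1 - x) + (x - a)\<close>, the reflection
    formula applies with \<open>d = x - a\<close>.\<close>
  have LR: "L = R + smult ((-1) ^ Suc m) (taylor_poly (2 * m + 1) a)"
  proof (rule poly_eq_poly_eq_iff[THEN iffD1], rule ext)
    fix x
    have "boggio m (x * (1 - a)) (a - x) = boggio m (a * (1 - x) + (x - a)) (- (x - a))"
      by (simp add: algebra_simps)
    also have "\<dots> = boggio m (a * (1 - x)) (x - a) + (-1) ^ m * (fact m)\<^sup>2 / fact (2 * m + 1) * (x - a) ^ (2 * m + 1)"
      by (rule boggio_reflect)
    also have "(x - a) ^ (2 * m + 1) = - ((a - x) ^ (2 * m + 1))"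
      using power_minus_odd[of "2 * m + 1" "a - x"] by simp
    finally have "boggio m (x * (1 - a)) (a - x) = boggio m (a * (1 - x)) (x - a)
      + (-1) ^ m * (fact m)\<^sup>2 / fact (2 * m + 1) * - ((a - x) ^ (2 * m + 1))" .
    moreover have "poly [:0, 1 - a:] x = x * (1 - a)" "poly [:a, -1:] x = a - x"
      "poly [:a, -a:] x = a * (1 - x)" "poly [:-a, 1:] x = x - a" by (simp_all add: algebra_simps)
    ultimately show "poly L x = poly (R + smult ((-1) ^ Suc m) (taylor_poly (2 * m + 1) a)) x"
      unfolding L_def R_def poly_smult poly_add poly_boggio_poly poly_taylor_poly
      by (simp add: field_simps del: fact_Suc)
  qed
  have L_dvd: "[:0, 1:] ^ ?n dvd L"
  proof -
    have "[:0, 1 - a:] = [:0, 1:] * [:1 - a:]" by simp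
    then show ?thesis unfolding L_def by (intro dvd_smult power_dvd_boggio_poly) (metis dvd_triv_left)
  qed
  have R_dvd: "[:-1, 1:] ^ ?n dvd R"
  proof -
    have "[:a, -a:] = [:-1, 1:] * [:-a:]" by simp
    then show ?thesis unfolding R_def by (intro dvd_smult power_dvd_boggio_poly) (metis dvd_triv_left)
  qed
  \<comment> \<open>To the right of \<open>a\<close> the truncated power is 0, so the error there is
    \<open>- p\<close> and has to be the derivative of \<open>R\<close>. The degree bound
    \<open>2 * m + 1\<close> on \<open>R\<close> leaves degree at most \<open>m\<close>.\<close>
  define p where "p = - (pderiv ^^ ?n) R"
  have degR: "degree R \<le> 2 * m + 1"
    unfolding R_def by (intro order_trans[OF degree_smult_le] degree_boggio_poly) auto
  have deg: "degree p < ?n"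
    using degR by (simp add: p_def degree_higher_pderiv del: funpow.simps)
  have DL: "(pderiv ^^ ?n) L = (pderiv ^^ ?n) R + taylor_poly m a"
  proof -
    have "(pderiv ^^ ?n) (taylor_poly (2 * m + 1) a) = smult ((-1) ^ ?n) (taylor_poly m a)"
      by (subst higher_pderiv_taylor_poly) (simp_all del: funpow.simps add: mult_2)
    then have "(pderiv ^^ ?n) (smult ((-1) ^ ?n) (taylor_poly (2 * m + 1) a)) = taylor_poly m a"
      unfolding higher_pderiv_smult by (simp del: funpow.simps power_Suc flip: power_add)
    then show ?thesis unfolding LR higher_pderiv_add by (simp only:)
  qed
  have eqa: "poly ((pderiv ^^ i) L) a = poly ((pderiv ^^ i) R) a" if "i \<le> m" for i
    unfolding LR higher_pderiv_add higher_pderiv_smult poly_add poly_smult poly_higher_pderiv_taylor_poly using that by simp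
  have error: "spline_error m a p x = (if x \<le> a then poly ((pderiv ^^ ?n) L) x else poly ((pderiv ^^ ?n) R) x)" for x
    by (simp add: spline_error_def p_def DL del: funpow.simps)
  have orth: "((\<lambda>x. spline_error m a p x * poly q x) has_integral 0) {0..1}" if q: "degree q < ?n" for q
  proof -
    note has_integral_piecewise[OF has_integral_poly_by_parts_left[OF a(1) q L_dvd] has_integral_poly_by_parts_right[OF a(2) q R_dvd] a]
    \<comment> \<open>The boundary terms of the two halves meet at \<open>a\<close> with opposite
      signs and cancel, since only derivatives of order at most \<open>m\<close> occur.\<close>
    moreover have "(\<Sum>j<?n. (-1) ^ j * poly ((pderiv ^^ (?n - Suc j)) L) a * poly ((pderiv ^^ j) q) a)
        = (\<Sum>j<?n. (-1) ^ j * poly ((pderiv ^^ (?n - Suc j)) R) a * poly ((pderiv ^^ j) q) a)"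
      using eqa by (intro sum.cong) auto
    moreover have "(\<lambda>x. spline_error m a p x * poly q x) = (\<lambda>x. if x \<le> a then poly ((pderiv ^^ ?n) L) x * poly q x else poly ((pderiv ^^ ?n) R) x * poly q x)"
      by (auto simp: error simp del: funpow.simps)
    ultimately show ?thesis by (simp del: funpow.simps)
  qed
  have norm: "((\<lambda>x. (spline_error m a p x)\<^sup>2) has_integral poly L a) {0..1}"
  proof -
    \<comment> \<open>The error is orthogonal to \<open>p\<close>, so its squared norm equals its
      pairing with the truncated power, which evaluates the Green function on the diagonal.\<close>
    have "((\<lambda>x. poly ((pderiv ^^ ?n) L) x * poly (taylor_poly m a) x) has_integral poly L a) {0..a}"
      using has_integral_poly_by_parts_left[OF a(1) _ L_dvd, of "taylor_poly m a"]
        sum_taylor_poly[of m ?n "\<lambda>j. poly ((pderiv ^^ j) L) a" a] by (simp add: degree_taylor_poly del: funpow.simps)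
    then have "((\<lambda>x. if x \<le> a then poly ((pderiv ^^ ?n) L) x * poly (taylor_poly m a) x else 0) has_integral poly L a) {0..1}"
      by (rule has_integral_le_subinterval[OF _ a])
    from has_integral_diff[OF this orth[OF deg]]
    have "((\<lambda>x. (if x \<le> a then poly ((pderiv ^^ ?n) L) x * poly (taylor_poly m a) x else 0) - spline_error m a p x * poly p x)
      has_integral poly L a) {0..1}" by simp
    moreover have "(if x \<le> a then poly ((pderiv ^^ ?n) L) x * poly (taylor_poly m a) x else 0) - spline_error m a p x * poly p x
      = (spline_error m a p x)\<^sup>2" for x
    proof -
      have "poly p x = - poly ((pderiv ^^ ?n) R) x" by (simp add: p_def)
      then show ?thesis by (simp add: error DL power2_eq_square algebra_simps del: funpow.simps)
    qed
    ultimately show ?thesis by simp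
  qed
  \<comment> \<open>On the diagonal the shift is 0, and \<open>0 ^ (m - j)\<close> leaves only the
    term \<open>j = m\<close>.\<close>
  have "boggio m (a * (1 - a)) 0 = (\<Sum>j\<le>m. if j = m then (a * (1 - a)) ^ (2 * m + 1) / real (2 * m + 1) else 0)"
    unfolding boggio_def
  proof (rule sum.cong)
    fix j assume "j \<in> {..m}"
    have eq: "m + 1 + m = 2 * m + 1" by simp
    have "real (m choose j) / M * (0 ^ (m - j) * U) = (if j = m then U / M else 0)" for M U :: real
      using \<open>j \<in> {..m}\<close> by (cases "j = m") simp_all
    then have "real (m choose j) / real (m + 1 + j) * (0 ^ (m - j) * (a * (1 - a)) ^ (m + 1 + j)) =
        (if j = m then (a * (1 - a)) ^ (m + 1 + j) / real (m + 1 + j) else 0)" .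
    also have "\<dots> = (if j = m then (a * (1 - a)) ^ (2 * m + 1) / real (2 * m + 1) else 0)"
      by (rule if_cong) (simp_all only: eq)
    finally show "real (m choose j) / real (m + 1 + j) * (0 ^ (m - j) * (a * (1 - a)) ^ (m + 1 + j)) =
        (if j = m then (a * (1 - a)) ^ (2 * m + 1) / real (2 * m + 1) else 0)" .
  qed simp
  moreover have "poly L a = 1 / (fact m)\<^sup>2 * boggio m (a * (1 - a)) 0"
    by (simp add: L_def poly_boggio_poly)
  ultimately have "poly L a = (a * (1 - a)) ^ (2 * m + 1) / (real (2 * m + 1) * (fact m)\<^sup>2)"
    by (simp del: of_nat_add power_Suc)
  moreover have "best_approx ?n m a p (poly L a)"
    unfolding best_approx_def using norm orth deg by blast
  ultimately show ?thesis by (intro exI[of _ p]) (simp only:)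
qed

section \<open>Shifted Legendre polynomials and raising the degree\<close>

definition parabola :: "real poly" where "parabola = [:0, -1, 1:]"

text \<open>Rodrigues' formula: this is \<open>fact n\<close> times the shifted Legendre polynomial
  on the unit interval.\<close>

definition rodrigues :: "nat \<Rightarrow> real poly" where
  "rodrigues n = (pderiv ^^ n) (parabola ^ n)"

lemma parabola_dvd: "[:0, 1:] ^ n dvd parabola ^ n" "[:-1, 1:] ^ n dvd parabola ^ n"
proof -
  have eq: "parabola = [:0, 1:] * [:-1, 1:]" by (simp add: parabola_def)
  have "parabola ^ n = [:0, 1:] ^ n * [:-1, 1:] ^ n" unfolding eq by (rule power_mult_distrib)
  then show "[:0, 1:] ^ n dvd parabola ^ n" "[:-1, 1:] ^ n dvd parabola ^ n"
    by (metis dvd_triv_left, metis dvd_triv_right)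
qed

lemma degree_rodrigues: "degree (rodrigues n) = n"
  by (simp add: rodrigues_def degree_higher_pderiv degree_power_eq parabola_def)

lemma rodrigues_orthogonal:
  assumes "degree q < n"
  shows "((\<lambda>x. poly (rodrigues n) x * poly q x) has_integral 0) {0..1}"
proof -
  have "(\<Sum>j<n. (-1) ^ j * poly ((pderiv ^^ (n - Suc j)) (parabola ^ n)) 1 * poly ((pderiv ^^ j) q) 1) = 0"
    using poly_higher_pderiv_eq_0[OF parabola_dvd(2)] by (intro sum.neutral) auto
  with has_integral_poly_by_parts_left[OF _ assms parabola_dvd(1), of 1] show ?thesis
    by (simp add: rodrigues_def)
qed

text \<open>The inner product with the truncated power. The lower derivative of
  \<open>parabola ^ n\<close> on the right still vanishes to order \<open>m + 1\<close> at 0, so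
  \<open>m + 1\<close> integrations by parts leave only its value at \<open>a\<close>.\<close>

lemma rodrigues_taylor_pairing:
  assumes "0 \<le> a" "m < n"
  shows "((\<lambda>x. poly (rodrigues n) x * poly (taylor_poly m a) x) has_integral
    poly ((pderiv ^^ (n - Suc m)) (parabola ^ n)) a) {0..a}"
proof -
  let ?P = "(pderiv ^^ (n - Suc m)) (parabola ^ n)"
  have "(pderiv ^^ Suc m) ?P = (pderiv ^^ (Suc m + (n - Suc m))) (parabola ^ n)"
    by (simp only: funpow_add comp_def)
  also have "\<dots> = rodrigues n" using assms(2) by (simp add: rodrigues_def del: funpow.simps)
  finally have P: "(pderiv ^^ Suc m) ?P = rodrigues n" .
  have "[:0, 1:] ^ Suc m dvd ?P"
    using linear_power_dvd_higher_pderiv[of 0 n "parabola ^ n" "n - Suc m"] parabola_dvd(1) assms(2) by simp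
  from has_integral_poly_by_parts_left[OF assms(1) _ this, of "taylor_poly m a"]
    sum_taylor_poly[of m "Suc m" "\<lambda>j. poly ((pderiv ^^ j) ?P) a" a]
  show ?thesis unfolding P by (simp add: degree_taylor_poly)
qed

text \<open>One factor is replaced by the multiple of \<open>taylor_poly n 1\<close> with the same
  leading coefficient; the rest has lower degree and is orthogonal. The remaining pairing is the
  primitive of \<open>parabola ^ n\<close> at 1, a beta integral.\<close>

lemma rodrigues_norm: "((\<lambda>x. (poly (rodrigues n) x)\<^sup>2) has_integral (fact n)\<^sup>2 / real (2 * n + 1)) {0..1}"
proof -
  from poly_primitive_exists[of 1 "parabola ^ n"] obtain P
    where P: "pderiv P = parabola ^ n" "poly P 0 = 0" by auto
  have DP: "(pderiv ^^ Suc n) P = rodrigues n" 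
    by (simp add: funpow_Suc_right P rodrigues_def del: funpow.simps)
  have P1: "poly P 1 = (-1) ^ n * ((fact n)\<^sup>2 / fact (2 * n + 1))"
  proof -
    have "(poly (parabola ^ n) has_integral poly P 1 - poly P 0) {0..1}"
      unfolding P(1)[symmetric]
      by (intro fundamental_theorem_of_calculus)
         (auto intro: has_field_derivative_at_within poly_DERIV simp flip: has_real_derivative_iff_has_vector_derivative)
    moreover have "poly (parabola ^ n) = (\<lambda>x. (-1) ^ n * (x * (1 - x)) ^ n)"
      by (simp add: parabola_def fun_eq_iff poly_power algebra_simps flip: power_mult_distrib)
    ultimately have "((\<lambda>x. (-1) ^ n * (x * (1 - x)) ^ n) has_integral poly P 1) {0..1}" using P by simp
    with has_integral_mult_right[OF has_integral_beta[of n], of "(-1) ^ n"] show ?thesis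
      by (auto dest: has_integral_unique)
  qed
  have D0: "poly ((pderiv ^^ i) P) 0 = 0" if "i \<le> n" for i
  proof (cases i)
    case (Suc k)
    then have "(pderiv ^^ i) P = (pderiv ^^ k) (parabola ^ n)"
      by (simp add: funpow_Suc_right P del: funpow.simps)
    then show ?thesis using poly_higher_pderiv_eq_0[of 0 n "parabola ^ n" k] parabola_dvd(1) that Suc by simp
  qed (simp add: P)
  let ?q = "taylor_poly n 1"
  have T: "((\<lambda>x. poly (rodrigues n) x * poly ?q x) has_integral poly P 1) {0..1}"
  proof -
    have "(\<Sum>j<Suc n. (-1) ^ j * poly ((pderiv ^^ (Suc n - Suc j)) P) 0 * poly ((pderiv ^^ j) ?q) 0) = 0"
      using D0 by (intro sum.neutral) auto
    moreover have "(\<Sum>j<Suc n. (-1) ^ j * poly ((pderiv ^^ (Suc n - Suc j)) P) 1 * poly ((pderiv ^^ j) ?q) 1) = poly P 1"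
      using sum_taylor_poly[of n "Suc n" "\<lambda>j. poly ((pderiv ^^ j) P) 1" 1] by simp
    ultimately show ?thesis
      using has_integral_poly_by_parts[of 0 1 ?q "Suc n" P] unfolding DP by (simp add: degree_taylor_poly)
  qed
  have lead: "coeff (rodrigues n) n = fact (2 * n) / fact n"
  proof -
    have "degree (parabola ^ n) = 2 * n" by (simp add: parabola_def degree_power_eq)
    then have "coeff (parabola ^ n) (2 * n) = 1"
      using lead_coeff_power[of parabola n] by (simp only:) (simp add: parabola_def)
    then have "coeff (rodrigues n) n = pochhammer (real (Suc n)) n"
      unfolding rodrigues_def coeff_higher_pderiv by (simp add: mult_2 flip: of_nat_Suc)
    also have "\<dots> = fact (2 * n) / fact n"
      using pochhammer_product[of n "2 * n" "1 :: real"] by (simp add: add.commute mult_2 flip: pochhammer_fact)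
    finally show ?thesis .
  qed
  have leadq: "coeff ?q n = (-1) ^ n / fact n"
    using lead_coeff_power[of "[:1, -1:] :: real poly" n] by (simp add: taylor_poly_def degree_power_eq)
  \<comment> \<open>The quotient of the two leading coefficients, so that the coefficient of order
    \<open>n\<close> cancels in \<open>r\<close>.\<close>
  define c :: real where "c = (-1) ^ n * fact (2 * n)"
  define r where "r = rodrigues n - smult c ?q"
  have "coeff r n = 0" by (simp add: r_def lead leadq c_def flip: power_add)
  have "((\<lambda>x. poly (rodrigues n) x * poly r x) has_integral 0) {0..1}"
  proof (cases "r = 0")
    case False
    have "degree r \<le> n" unfolding r_def by (intro degree_diff_le) (auto simp: degree_rodrigues degree_taylor_poly intro: order_trans[OF degree_smult_le])
    moreover have "degree r \<noteq> n" using \<open>coeff r n = 0\<close> False leading_coeff_0_iff by metis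
    ultimately show ?thesis by (intro rodrigues_orthogonal) simp
  qed simp
  from has_integral_add[OF this has_integral_mult_right[OF T, of c]]
  have "((\<lambda>x. poly (rodrigues n) x * poly r x + c * (poly (rodrigues n) x * poly ?q x)) has_integral c * poly P 1) {0..1}" by simp
  moreover have "poly (rodrigues n) x * poly r x + c * (poly (rodrigues n) x * poly ?q x) = (poly (rodrigues n) x)\<^sup>2" for x
    by (simp add: r_def power2_eq_square algebra_simps)
  moreover have "c * poly P 1 = (fact n)\<^sup>2 / real (2 * n + 1)"
  proof -
    have "(fact (2 * n + 1) :: real) = real (2 * n + 1) * fact (2 * n)" by simp
    moreover have "(-1) ^ n * (-1) ^ n = (1 :: real)" by (simp flip: power_add)
    ultimately show ?thesis by (simp add: c_def P1 del: fact_Suc of_nat_Suc of_nat_add)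
  qed
  ultimately show ?thesis by simp
qed

text \<open>Allowing degree \<open>n\<close> adds one orthogonal direction,
  \<open>rodrigues n\<close>. The approximation gains the projection onto it, and by Pythagoras the
  squared error loses \<open>e\<^sup>2 / s\<close>, with \<open>e\<close> the inner product and
  \<open>s\<close> the squared norm.\<close>

lemma best_approx_step:
  assumes best: "best_approx n m a p V" and a: "0 \<le> a" "a \<le> 1" and "m < n"
  shows "\<exists>p. best_approx (Suc n) m a p
    (V - (poly ((pderiv ^^ (n - Suc m)) (parabola ^ n)) a)\<^sup>2 * real (2 * n + 1) / (fact n)\<^sup>2)"
proof -
  define e where "e = poly ((pderiv ^^ (n - Suc m)) (parabola ^ n)) a"
  define s where "s = (fact n)\<^sup>2 / real (2 * n + 1)"
  have "s > 0" by (simp add: s_def)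
  let ?Q = "rodrigues n" and ?R = "spline_error m a p"
  define p' where "p' = p + smult (e / s) ?Q"
  have deg: "degree p < n" and orth: "\<And>q. degree q < n \<Longrightarrow> ((\<lambda>x. ?R x * poly q x) has_integral 0) {0..1}"
    and norm: "((\<lambda>x. (?R x)\<^sup>2) has_integral V) {0..1}"
    using best by (auto simp: best_approx_def)
  have error: "spline_error m a p' x = ?R x - e / s * poly ?Q x" for x
    by (simp add: spline_error_def p'_def)
  have RQ: "((\<lambda>x. ?R x * poly ?Q x) has_integral e) {0..1}"
  proof -
    have "((\<lambda>x. if x \<le> a then poly ?Q x * poly (taylor_poly m a) x else 0) has_integral e) {0..1}"
      unfolding e_def using rodrigues_taylor_pairing[OF a(1) \<open>m < n\<close>] by (rule has_integral_le_subinterval[OF _ a])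
    from has_integral_diff[OF this rodrigues_orthogonal[OF deg]]
    have "((\<lambda>x. (if x \<le> a then poly ?Q x * poly (taylor_poly m a) x else 0) - poly ?Q x * poly p x) has_integral e) {0..1}"
      by simp
    then show ?thesis by (rule has_integral_eq[rotated]) (auto simp: spline_error_def algebra_simps)
  qed
  have QQ: "((\<lambda>x. (poly ?Q x)\<^sup>2) has_integral s) {0..1}" unfolding s_def by (rule rodrigues_norm)
  have "degree p' < Suc n"
    using deg degree_add_le[of p n "smult (e / s) ?Q"] degree_smult_le[of "e / s" ?Q] by (simp add: p'_def degree_rodrigues)
  moreover have "((\<lambda>x. spline_error m a p' x * poly q x) has_integral 0) {0..1}" if "degree q < Suc n" for q
  proof -
    \<comment> \<open>Splitting off the leading term along \<open>?Q\<close> leaves a remainder of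
      degree below \<open>n\<close>, to which both the old error and \<open>?Q\<close> are
      orthogonal.\<close>
    define c where "c = coeff q n / lead_coeff ?Q"
    define r where "r = q - smult c ?Q"
    have "?Q \<noteq> 0" using degree_rodrigues[of n] \<open>m < n\<close> by auto
    then have "coeff r n = 0" by (simp add: r_def c_def degree_rodrigues) (metis degree_rodrigues leading_coeff_0_iff)
    moreover have "degree r \<le> n" unfolding r_def using that
      by (intro degree_diff_le) (auto simp: degree_rodrigues intro: order_trans[OF degree_smult_le])
    ultimately have r: "degree r < n" 
      using \<open>m < n\<close> by (metis degree_0 leading_coeff_0_iff le_neq_implies_less not_less_zero gr0I)
    have "((\<lambda>x. (?R x * poly r x - e / s * (poly ?Q x * poly r x)) + c * (?R x * poly ?Q x - e / s * (poly ?Q x)\<^sup>2))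
       has_integral (0 - e / s * 0) + c * (e - e / s * s)) {0..1}"
      by (intro has_integral_add has_integral_diff has_integral_mult_right orth r rodrigues_orthogonal RQ QQ)
    then have "((\<lambda>x. (?R x * poly r x - e / s * (poly ?Q x * poly r x)) + c * (?R x * poly ?Q x - e / s * (poly ?Q x)\<^sup>2))
       has_integral 0) {0..1}" using \<open>s > 0\<close> by simp
    then show ?thesis
      by (rule has_integral_eq[rotated]) (simp add: error r_def power2_eq_square algebra_simps)
  qed
  moreover have "((\<lambda>x. (spline_error m a p' x)\<^sup>2) has_integral V - e\<^sup>2 / s) {0..1}"
  proof -
    have "((\<lambda>x. (?R x)\<^sup>2 - 2 * (e / s) * (?R x * poly ?Q x) + (e / s)\<^sup>2 * (poly ?Q x)\<^sup>2)
       has_integral V - 2 * (e / s) * e + (e / s)\<^sup>2 * s) {0..1}"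
      by (intro has_integral_add has_integral_diff has_integral_mult_right norm RQ QQ)
    also have "V - 2 * (e / s) * e + (e / s)\<^sup>2 * s = V - e\<^sup>2 / s"
      using \<open>s > 0\<close> by (simp add: field_simps power2_eq_square)
    finally show ?thesis
      by (rule has_integral_eq[rotated]) (simp add: error power2_eq_square algebra_simps)
  qed
  ultimately have "best_approx (Suc n) m a p' (V - e\<^sup>2 / s)"
    unfolding best_approx_def by blast
  moreover have "e\<^sup>2 / s = e\<^sup>2 * real (2 * n + 1) / (fact n)\<^sup>2" by (simp add: s_def)
  ultimately show ?thesis unfolding e_def by auto
qed

theorem best_approx_exists:
  assumes a: "0 \<le> a" "a \<le> 1"
  shows "\<exists>p. best_approx (Suc m + k) m a p
    ((a * (1 - a)) ^ (2 * m + 1) / (real (2 * m + 1) * (fact m)\<^sup>2)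
     - (\<Sum>i<k. (poly ((pderiv ^^ i) (parabola ^ (Suc m + i))) a)\<^sup>2 * real (2 * (Suc m + i) + 1) / (fact (Suc m + i))\<^sup>2))"
proof (induction k)
  case 0
  then show ?case using best_approx_base[OF a] by simp
next
  case (Suc k)
  from Suc.IH obtain p where p: "best_approx (Suc m + k) m a p
    ((a * (1 - a)) ^ (2 * m + 1) / (real (2 * m + 1) * (fact m)\<^sup>2)
     - (\<Sum>i<k. (poly ((pderiv ^^ i) (parabola ^ (Suc m + i))) a)\<^sup>2 * real (2 * (Suc m + i) + 1) / (fact (Suc m + i))\<^sup>2))" ..
  have "m < Suc m + k" "Suc m + k - Suc m = k" by simp_all
  from best_approx_step[OF p a this(1), unfolded this(2)] show ?case
    by (simp only: sum.lessThan_Suc diff_diff_eq add_Suc_right)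
qed

section \<open>The squared error for \<open>k = 5\<close>\<close>

definition parabola_deriv :: "nat \<Rightarrow> nat \<Rightarrow> real \<Rightarrow> real" where
  "parabola_deriv i M x = poly ((pderiv ^^ i) (parabola ^ M)) x"

lemma higher_pderiv_linear_mult:
  fixes q :: "real poly"
  shows "(pderiv ^^ Suc i) ([:b, c:] * q) = [:b, c:] * (pderiv ^^ Suc i) q + smult (c * real (Suc i)) ((pderiv ^^ i) q)"
proof (induction i)
  case 0
  have "pderiv [:b, c:] = [:c:]" "q * [:c:] = smult c q" by (simp_all add: pderiv_pCons)
  then show ?case by (simp add: pderiv_mult del: mult_pCons_left mult_pCons_right)
next
  case (Suc i)
  have c: "pderiv [:b, c:] = [:c:]" by (simp add: pderiv_pCons)
  have "(pderiv ^^ Suc (Suc i)) ([:b, c:] * q) = pderiv ((pderiv ^^ Suc i) ([:b, c:] * q))" by simp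
  also have "\<dots> = pderiv ([:b, c:] * (pderiv ^^ Suc i) q + smult (c * real (Suc i)) ((pderiv ^^ i) q))"
    by (simp only: Suc)
  also have "\<dots> = [:b, c:] * (pderiv ^^ Suc (Suc i)) q + ([:c:] * (pderiv ^^ Suc i) q + smult (c * real (Suc i)) ((pderiv ^^ Suc i) q))"
    unfolding pderiv_add pderiv_mult pderiv_smult c by (simp add: mult.commute)
  also have "[:c:] * (pderiv ^^ Suc i) q + smult (c * real (Suc i)) ((pderiv ^^ Suc i) q) = smult (c * real (Suc (Suc i))) ((pderiv ^^ Suc i) q)"
  proof -
    have "c * real (Suc (Suc i)) = c + c * real (Suc i)" by (simp add: algebra_simps)
    then show ?thesis by (simp add: smult_add_left del: funpow.simps of_nat_Suc)
  qed
  finally show ?case .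
qed

lemma pderiv_parabola_power: "pderiv (parabola ^ Suc M) = smult (real (Suc M)) ([:-1, 2:] * parabola ^ M)"
proof -
  have "pderiv parabola = [:-1, 2:]" by (simp add: parabola_def pderiv_pCons)
  then show ?thesis by (simp only: pderiv_power_Suc mult_smult_left mult.commute)
qed

lemma parabola_deriv_0: "parabola_deriv 0 M x = (x\<^sup>2 - x) ^ M"
  by (simp add: parabola_deriv_def parabola_def power2_eq_square algebra_simps)

lemma parabola_deriv_1: "parabola_deriv (Suc 0) (Suc M) x = real (Suc M) * ((2 * x - 1) * parabola_deriv 0 M x)"
  by (simp add: parabola_deriv_def pderiv_parabola_power algebra_simps del: power_Suc)

text \<open>One differentiation of the power produces the linear factor \<open>2 * x - 1\<close>;
  Leibniz's rule with a linear factor has only two terms. Order and exponent drop together until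
  only powers of the parabola remain.\<close>

lemma parabola_deriv_rec:
  "parabola_deriv (Suc (Suc i)) (Suc M) x =
    real (Suc M) * ((2 * x - 1) * parabola_deriv (Suc i) M x + 2 * real (Suc i) * parabola_deriv i M x)"
proof -
  have "(pderiv ^^ Suc (Suc i)) (parabola ^ Suc M) = (pderiv ^^ Suc i) (pderiv (parabola ^ Suc M))"
    by (simp only: funpow_Suc_right comp_def)
  also have "\<dots> = smult (real (Suc M)) ([:-1, 2:] * (pderiv ^^ Suc i) (parabola ^ M) + smult (2 * real (Suc i)) ((pderiv ^^ i) (parabola ^ M)))"
    unfolding pderiv_parabola_power higher_pderiv_smult higher_pderiv_linear_mult ..
  finally show ?thesis
    by (simp add: parabola_deriv_def algebra_simps del: funpow.simps power_Suc of_nat_Suc)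
qed

lemma best_approx_error_eq_f5:
  fixes a :: real
  shows "(a * (1 - a)) ^ (2 * m + 1) / (real (2 * m + 1) * (fact m)\<^sup>2)
     - (\<Sum>i<5. (poly ((pderiv ^^ i) (parabola ^ (Suc m + i))) a)\<^sup>2 * real (2 * (Suc m + i) + 1) / (fact (Suc m + i))\<^sup>2)
    = f5 (m + 6) (a\<^sup>2 - a) / ((fact (m + 3))\<^sup>2 * (2 * real m + 1))"
proof -
  \<comment> \<open>The derivatives below are \<open>T\<close> times polynomials in \<open>s\<close>
    and \<open>t\<close>, with \<open>s\<close> occurring to an odd power exactly for odd order;
    their squares therefore involve \<open>s\<close> only through
    \<open>s\<^sup>2 = 1 + 4 * t\<close>.\<close>
  define t s M where "t = a\<^sup>2 - a" and "s = 2 * a - 1" and "M = real m"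
  have s2: "s\<^sup>2 = 1 + 4 * t" by (simp add: s_def t_def power2_eq_square algebra_simps)
  define T where "T = t ^ (m + 1)"
  have tp: "t ^ (m + 2) = t * T" "t ^ (m + 3) = t\<^sup>2 * T" by (simp_all add: T_def power_add power2_eq_square power3_eq_cube)
  have e0: "parabola_deriv 0 (m + 1) a = T"
    by (simp add: parabola_deriv_0 T_def t_def)
  have p0: "parabola_deriv 0 (m + 2) a = t * T" "parabola_deriv 0 (m + 3) a = t\<^sup>2 * T"
    by (simp_all only: parabola_deriv_0 tp t_def[symmetric])
  have e1: "parabola_deriv 1 (m + 2) a = (M + 2) * T * s"
    using parabola_deriv_1[of "m + 1" a] e0 by (simp add: M_def s_def)
  have e2: "parabola_deriv 2 (m + 3) a = (M + 3) * T * ((M + 2) * s\<^sup>2 + 2 * t)" 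
  proof -
    have "parabola_deriv 2 (m + 3) a = (M + 3) * (s * parabola_deriv 1 (m + 2) a + 2 * parabola_deriv 0 (m + 2) a)"
      using parabola_deriv_rec[of 0 "m + 2" a] by (simp add: numeral_2_eq_2 numeral_3_eq_3 M_def s_def)
    then show ?thesis unfolding e1 p0 by algebra
  qed
  have e1': "parabola_deriv 1 (m + 3) a = (M + 3) * T * s * t"
    using parabola_deriv_1[of "m + 2" a, unfolded p0] by (simp add: numeral_3_eq_3 M_def s_def)
  have e3: "parabola_deriv 3 (m + 4) a = (M + 4) * (M + 3) * T * s * ((M + 2) * s\<^sup>2 + 6 * t)"
  proof -
    have "parabola_deriv 3 (m + 4) a = (M + 4) * (s * parabola_deriv 2 (m + 3) a + 4 * parabola_deriv 1 (m + 3) a)"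
      using parabola_deriv_rec[of 1 "m + 3" a] by (simp add: eval_nat_numeral M_def s_def)
    then show ?thesis unfolding e2 e1' by algebra
  qed
  have e2': "parabola_deriv 2 (m + 4) a = (M + 4) * T * t * ((M + 3) * s\<^sup>2 + 2 * t)" 
  proof -
    have "parabola_deriv 2 (m + 4) a = (M + 4) * (s * parabola_deriv 1 (m + 3) a + 2 * parabola_deriv 0 (m + 3) a)"
      using parabola_deriv_rec[of 0 "m + 3" a] by (simp add: eval_nat_numeral M_def s_def)
    then show ?thesis unfolding e1' p0 by algebra
  qed
  have e4: "parabola_deriv 4 (m + 5) a = (M + 5) * (M + 4) * T * ((M + 3) * (M + 2) * s ^ 4 + 12 * (M + 3) * s\<^sup>2 * t + 12 * t\<^sup>2)"
  proof -
    have "parabola_deriv 4 (m + 5) a = (M + 5) * (s * parabola_deriv 3 (m + 4) a + 6 * parabola_deriv 2 (m + 4) a)"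
      using parabola_deriv_rec[of 2 "m + 4" a] by (simp add: eval_nat_numeral M_def s_def)
    then show ?thesis unfolding e3 e2' by algebra
  qed
  define f where "f = (fact m :: real)"
  have "f > 0" "M \<ge> 0" by (simp_all add: f_def M_def)
  have f1: "fact (m + 1) = (M + 1) * f" by (simp add: f_def M_def)
  have f2: "fact (m + 2) = (M + 2) * ((M + 1) * f)" using f1 fact_Suc[of "m + 1"] by (simp add: M_def)
  have f3: "fact (m + 3) = (M + 3) * ((M + 2) * ((M + 1) * f))"
    using f2 fact_Suc[of "m + 2"] by (simp add: M_def eval_nat_numeral)
  have f4: "fact (m + 4) = (M + 4) * ((M + 3) * ((M + 2) * ((M + 1) * f)))"
    using f3 fact_Suc[of "m + 3"] by (simp add: M_def eval_nat_numeral)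
  have f5: "fact (m + 5) = (M + 5) * ((M + 4) * ((M + 3) * ((M + 2) * ((M + 1) * f))))"
    using f4 fact_Suc[of "m + 4"] by (simp add: M_def eval_nat_numeral)
  have base: "(a * (1 - a)) ^ (2 * m + 1) = - (t ^ (2 * m + 1))"
  proof -
    have "a * (1 - a) = - t" by (simp add: t_def power2_eq_square algebra_simps)
    then show ?thesis using power_minus_odd[of "2 * m + 1" t] by simp
  qed
  have sum: "(\<Sum>i<5. (poly ((pderiv ^^ i) (parabola ^ (Suc m + i))) a)\<^sup>2 * real (2 * (Suc m + i) + 1) / (fact (Suc m + i))\<^sup>2)
    = (parabola_deriv 0 (m + 1) a)\<^sup>2 * (2 * M + 3) / (fact (m + 1))\<^sup>2
    + (parabola_deriv 1 (m + 2) a)\<^sup>2 * (2 * M + 5) / (fact (m + 2))\<^sup>2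
    + (parabola_deriv 2 (m + 3) a)\<^sup>2 * (2 * M + 7) / (fact (m + 3))\<^sup>2
    + (parabola_deriv 3 (m + 4) a)\<^sup>2 * (2 * M + 9) / (fact (m + 4))\<^sup>2
    + (parabola_deriv 4 (m + 5) a)\<^sup>2 * (2 * M + 11) / (fact (m + 5))\<^sup>2"
  proof -
    have 5: "(\<Sum>i<5. g i) = g 0 + g 1 + g 2 + g 3 + g 4" for g :: "nat \<Rightarrow> real"
      by (simp add: eval_nat_numeral)
    have idx: "m + 1 + 0 = m + 1" "m + 1 + 1 = m + 2" "m + 1 + 2 = m + 3" "m + 1 + 3 = m + 4" "m + 1 + 4 = m + 5"
      "2 * M + 3 + 2 * real 0 = 2 * M + 3" "2 * M + 3 + 2 * real 1 = 2 * M + 5" "2 * M + 3 + 2 * real 2 = 2 * M + 7"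
      "2 * M + 3 + 2 * real 3 = 2 * M + 9" "2 * M + 3 + 2 * real 4 = 2 * M + 11" by simp_all
    have "(\<Sum>i<5. (poly ((pderiv ^^ i) (parabola ^ (Suc m + i))) a)\<^sup>2 * real (2 * (Suc m + i) + 1) / (fact (Suc m + i))\<^sup>2)
      = (\<Sum>i<5. (parabola_deriv i (m + 1 + i) a)\<^sup>2 * (2 * M + 3 + 2 * real i) / (fact (m + 1 + i))\<^sup>2)"
      by (intro sum.cong) (simp_all add: parabola_deriv_def M_def del: fact_Suc power_Suc)
    also have "\<dots> = (parabola_deriv 0 (m + 1) a)\<^sup>2 * (2 * M + 3) / (fact (m + 1))\<^sup>2
      + (parabola_deriv 1 (m + 2) a)\<^sup>2 * (2 * M + 5) / (fact (m + 2))\<^sup>2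
      + (parabola_deriv 2 (m + 3) a)\<^sup>2 * (2 * M + 7) / (fact (m + 3))\<^sup>2
      + (parabola_deriv 3 (m + 4) a)\<^sup>2 * (2 * M + 9) / (fact (m + 4))\<^sup>2
      + (parabola_deriv 4 (m + 5) a)\<^sup>2 * (2 * M + 11) / (fact (m + 5))\<^sup>2"
      unfolding 5 idx ..
    finally show ?thesis .
  qed
  \<comment> \<open>\<open>w\<close> is the reciprocal of \<open>fact (m + 3)\<close>, the factorial
    in the claim, and \<open>U\<close> is the common power of \<open>t\<close>. The only denominator
    left is then \<open>2 * M + 1\<close>.\<close>
  define U w where "U = t ^ (2 * m + 1)" and "w = 1 / ((M + 1) * (M + 2) * (M + 3) * f)"
  have T2: "T\<^sup>2 = U * t"
    unfolding T_def U_def mult_2 power_add power2_eq_square by (simp add: mult_ac)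
  have nz: "M + 1 \<noteq> 0" "M + 2 \<noteq> 0" "M + 3 \<noteq> 0" "M + 4 \<noteq> 0" "M + 5 \<noteq> 0" "2 * M + 1 \<noteq> 0" "f \<noteq> 0"
    using \<open>M \<ge> 0\<close> \<open>f > 0\<close> by auto
  have sq: "x\<^sup>2 * c / y\<^sup>2 = c * (x / y)\<^sup>2" for x y c :: real
    by (simp add: power_divide)
  have q0: "parabola_deriv 0 (m + 1) a / fact (m + 1) = T * (M + 2) * (M + 3) * w"
    unfolding e0 f1 w_def using nz by (simp add: divide_simps)
  have q1: "parabola_deriv 1 (m + 2) a / fact (m + 2) = T * s * (M + 2) * (M + 3) * w"
    unfolding e1 f2 w_def using nz by (simp add: divide_simps)
  have q2: "parabola_deriv 2 (m + 3) a / fact (m + 3) = T * (M + 3) * ((M + 2) * s\<^sup>2 + 2 * t) * w"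
    unfolding e2 f3 w_def using nz by (simp add: divide_simps)
  have q3: "parabola_deriv 3 (m + 4) a / fact (m + 4) = T * s * (M + 3) * ((M + 2) * s\<^sup>2 + 6 * t) * w"
    unfolding e3 f4 w_def using nz by (simp add: divide_simps)
  have q4: "parabola_deriv 4 (m + 5) a / fact (m + 5) =
      T * ((M + 3) * (M + 2) * s ^ 4 + 12 * (M + 3) * s\<^sup>2 * t + 12 * t\<^sup>2) * w"
    unfolding e4 f5 w_def using nz by (simp add: divide_simps)
  have b: "(a * (1 - a)) ^ (2 * m + 1) / (real (2 * m + 1) * (fact m)\<^sup>2)
      = - U * ((M + 1) * (M + 2) * (M + 3) * w)\<^sup>2 / (2 * M + 1)"
  proof -
    have "1 / f = (M + 1) * (M + 2) * (M + 3) * w" unfolding w_def using nz by (simp add: divide_simps)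
    then have "1 / f\<^sup>2 = ((M + 1) * (M + 2) * (M + 3) * w)\<^sup>2" by (metis power_one_over)
    moreover have "real (2 * m + 1) = 2 * M + 1" by (simp add: M_def)
    ultimately show ?thesis unfolding base f_def[symmetric] U_def[symmetric]
      by (metis (no_types, lifting) divide_divide_eq_left mult.commute times_divide_eq_right mult.right_neutral)
  qed
  have r: "f5 (m + 6) t / ((fact (m + 3))\<^sup>2 * (2 * M + 1)) = f5 (m + 6) t * w\<^sup>2 / (2 * M + 1)"
    unfolding f3 w_def by (simp add: power_divide power_mult_distrib mult_ac)
  have f5: "f5 (m + 6) t = - U * (16 * (2*M + 11) * (2*M + 9)\<^sup>2 * (2*M + 7)\<^sup>2 * (2*M + 1) * t ^ 5
      + 80 * (M + 5) * (M + 3) * (2*M + 9) * (2*M + 7)\<^sup>2 * (2*M + 1) * t ^ 4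
      + 40 * (M + 4) * (M + 3) * (2*M + 9) * (2*M + 7) * (2*M + 5) * (2*M + 1) * t ^ 3
      + 40 * (M + 4) * (M + 3)\<^sup>2 * (M + 2) * (2*M + 7) * (2*M + 1) * t\<^sup>2
      + 5 * (M + 3)\<^sup>2 * (M + 2)\<^sup>2 * (2*M + 7) * (2*M + 1) * t
      + (M + 3)\<^sup>2 * (M + 2)\<^sup>2 * (M + 1)\<^sup>2)"
  proof -
    have "2 * (m + 6) - 11 = 2 * m + 1" "real (m + 6) = M + 6" by (simp_all add: M_def)
    then show ?thesis unfolding f5_def Let_def U_def by (simp add: algebra_simps)
  qed
  have clear: "B / (2 * M + 1) - S = F / (2 * M + 1)" if "(2 * M + 1) * S = B - F" for S B F
  proof -
    have "B - F = (2 * M + 1) * S" using that by simp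
    then have "B / (2 * M + 1) - F / (2 * M + 1) = S" using nz(6) by (simp flip: diff_divide_distrib)
    then show ?thesis by linarith
  qed
  have s4: "s ^ 4 = (1 + 4 * t)\<^sup>2"
    unfolding s2[symmetric] by simp
  have "(2 * M + 1) * (T\<^sup>2 * w\<^sup>2 * ((2 * M + 3) * ((M + 2) * (M + 3))\<^sup>2
      + (2 * M + 5) * (1 + 4 * t) * ((M + 2) * (M + 3))\<^sup>2
      + (2 * M + 7) * ((M + 3) * ((M + 2) * (1 + 4 * t) + 2 * t))\<^sup>2
      + (2 * M + 9) * (1 + 4 * t) * ((M + 3) * ((M + 2) * (1 + 4 * t) + 6 * t))\<^sup>2
      + (2 * M + 11) * ((M + 3) * (M + 2) * (1 + 4 * t)\<^sup>2 + 12 * (M + 3) * (1 + 4 * t) * t + 12 * t\<^sup>2)\<^sup>2))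
    = - U * ((M + 1) * (M + 2) * (M + 3) * w)\<^sup>2 - f5 (m + 6) t * w\<^sup>2"
    unfolding f5 T2 by algebra
  then have "- U * ((M + 1) * (M + 2) * (M + 3) * w)\<^sup>2 / (2 * M + 1) - T\<^sup>2 * w\<^sup>2 * ((2 * M + 3) * ((M + 2) * (M + 3))\<^sup>2
      + (2 * M + 5) * (1 + 4 * t) * ((M + 2) * (M + 3))\<^sup>2
      + (2 * M + 7) * ((M + 3) * ((M + 2) * (1 + 4 * t) + 2 * t))\<^sup>2
      + (2 * M + 9) * (1 + 4 * t) * ((M + 3) * ((M + 2) * (1 + 4 * t) + 6 * t))\<^sup>2
      + (2 * M + 11) * ((M + 3) * (M + 2) * (1 + 4 * t)\<^sup>2 + 12 * (M + 3) * (1 + 4 * t) * t + 12 * t\<^sup>2)\<^sup>2)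
    = f5 (m + 6) t * w\<^sup>2 / (2 * M + 1)"
    by (rule clear)
  moreover have "T\<^sup>2 * w\<^sup>2 * ((2 * M + 3) * ((M + 2) * (M + 3))\<^sup>2
      + (2 * M + 5) * (1 + 4 * t) * ((M + 2) * (M + 3))\<^sup>2
      + (2 * M + 7) * ((M + 3) * ((M + 2) * (1 + 4 * t) + 2 * t))\<^sup>2
      + (2 * M + 9) * (1 + 4 * t) * ((M + 3) * ((M + 2) * (1 + 4 * t) + 6 * t))\<^sup>2
      + (2 * M + 11) * ((M + 3) * (M + 2) * (1 + 4 * t)\<^sup>2 + 12 * (M + 3) * (1 + 4 * t) * t + 12 * t\<^sup>2)\<^sup>2)
    = (2 * M + 3) * (T * (M + 2) * (M + 3) * w)\<^sup>2
    + (2 * M + 5) * (T * s * (M + 2) * (M + 3) * w)\<^sup>2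
    + (2 * M + 7) * (T * (M + 3) * ((M + 2) * s\<^sup>2 + 2 * t) * w)\<^sup>2
    + (2 * M + 9) * (T * s * (M + 3) * ((M + 2) * s\<^sup>2 + 6 * t) * w)\<^sup>2
    + (2 * M + 11) * (T * ((M + 3) * (M + 2) * s ^ 4 + 12 * (M + 3) * s\<^sup>2 * t + 12 * t\<^sup>2) * w)\<^sup>2"
    unfolding power_mult_distrib s4 s2 by algebra
  ultimately show ?thesis
    unfolding sum unfolding sq q0 q1 q2 q3 q4 b t_def[symmetric] M_def[symmetric] r by simp
qed

section \<open>The maximum of \<open>f5\<close>\<close>

text \<open>With \<open>t = x\<^sup>2 - x\<close>, the sixth derivative of \<open>t\<^sup>N\<close> with respect to \<open>x\<close> is
  \<open>N (N - 1) (N - 2) t\<^sup>N\<^sup>-\<^sup>6\<close> times this cubic.\<close>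

definition crit_cubic :: "real \<Rightarrow> real \<Rightarrow> real" where
  "crit_cubic N t = (N - 3) * (N - 4) * (N - 5) * (1 + 4 * t) ^ 3 + 30 * (N - 3) * (N - 4) * (1 + 4 * t)\<^sup>2 * t
     + 180 * (N - 3) * (1 + 4 * t) * t\<^sup>2 + 120 * t ^ 3"

definition crit_cubic' :: "real \<Rightarrow> real \<Rightarrow> real" where
  "crit_cubic' N t = 12 * (N - 3) * (N - 4) * (N - 5) * (1 + 4 * t)\<^sup>2
     + 30 * (N - 3) * (N - 4) * (8 * (1 + 4 * t) * t + (1 + 4 * t)\<^sup>2)
     + 180 * (N - 3) * (4 * t\<^sup>2 + 2 * (1 + 4 * t) * t) + 360 * t\<^sup>2"

lemma crit_cubic_deriv: "(crit_cubic N has_real_derivative crit_cubic' N t) (at t)"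
  unfolding crit_cubic_def [abs_def] crit_cubic'_def
  by (auto intro!: derivative_eq_intros simp: algebra_simps power2_eq_square power3_eq_cube)

section \<open>The derivative of \<open>f5\<close> and its critical points\<close>

definition quintic :: "real \<Rightarrow> real \<Rightarrow> real" where
  "quintic N t = 16 * (2*N - 1) * (2*N - 3)\<^sup>2 * (2*N - 5)\<^sup>2 * (2*N - 11) * t ^ 5
      + 80 * (N - 1) * (N - 3) * (2*N - 3) * (2*N - 5)\<^sup>2 * (2*N - 11) * t ^ 4
      + 40 * (N - 2) * (N - 3) * (2*N - 3) * (2*N - 5) * (2*N - 7) * (2*N - 11) * t ^ 3
      + 40 * (N - 2) * (N - 3)\<^sup>2 * (N - 4) * (2*N - 5) * (2*N - 11) * t\<^sup>2
      + 5 * (N - 3)\<^sup>2 * (N - 4)\<^sup>2 * (2*N - 5) * (2*N - 11) * t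
      + (N - 3)\<^sup>2 * (N - 4)\<^sup>2 * (N - 5)\<^sup>2"

lemma f5_eq: "f5 n t = - (t ^ (2 * n - 11)) * quintic (real n) t"
  by (simp add: f5_def quintic_def Let_def)

definition quintic' :: "real \<Rightarrow> real \<Rightarrow> real" where
  "quintic' N t = 80 * (2*N - 1) * (2*N - 3)\<^sup>2 * (2*N - 5)\<^sup>2 * (2*N - 11) * t ^ 4
      + 320 * (N - 1) * (N - 3) * (2*N - 3) * (2*N - 5)\<^sup>2 * (2*N - 11) * t ^ 3
      + 120 * (N - 2) * (N - 3) * (2*N - 3) * (2*N - 5) * (2*N - 7) * (2*N - 11) * t\<^sup>2
      + 80 * (N - 2) * (N - 3)\<^sup>2 * (N - 4) * (2*N - 5) * (2*N - 11) * t
      + 5 * (N - 3)\<^sup>2 * (N - 4)\<^sup>2 * (2*N - 5) * (2*N - 11)"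

lemma quintic_deriv: "(quintic N has_real_derivative quintic' N t) (at t)"
proof -
  have *: "((\<lambda>t. a * t ^ 5 + b * t ^ 4 + c * t ^ 3 + d * t\<^sup>2 + e * t + k) has_real_derivative
      5 * a * t ^ 4 + 4 * b * t ^ 3 + 3 * c * t\<^sup>2 + 2 * d * t + e) (at t)" for a b c d e k :: real
    by (auto intro!: derivative_eq_intros)
  show ?thesis
    unfolding quintic_def [abs_def] quintic'_def by (rule DERIV_cong[OF *]) algebra
qed

text \<open>Up to a power of \<open>t\<close>, the left side is three times the derivative of
  \<open>t ^ (2 * N - 11) * quintic N t\<close>. Its factorisation, an identity of polynomials in
  \<open>N\<close> and \<open>t\<close>, exhibits the nonzero critical points as roots of two
  cubics.\<close>

lemma quintic_ode:
  "3 * ((2*N - 11) * quintic N t + t * quintic' N t)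
    = (2*N - 11) * (3 * crit_cubic N t - t * crit_cubic' N t) * crit_cubic N t"
  unfolding quintic_def quintic'_def crit_cubic_def crit_cubic'_def by algebra

lemma f5_deriv:
  assumes "n \<ge> 6"
  shows "(f5 n has_real_derivative - (t ^ (2 * n - 12)) * ((2 * real n - 11) / 3)
    * (3 * crit_cubic n t - t * crit_cubic' n t) * crit_cubic n t) (at t)"
proof -
  have e: "2 * n - 11 = Suc (2 * n - 12)" using assms by simp
  have r: "real (Suc (2 * n - 12)) = 2 * real n - 11" using assms by (simp add: of_nat_diff)
  have 1: "((\<lambda>t. - (t ^ (2 * n - 11))) has_real_derivative - ((2 * real n - 11) * t ^ (2 * n - 12))) (at t)"
    using DERIV_minus[OF DERIV_pow[of "2 * n - 11" t]] e r by simp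
  have "f5 n = (\<lambda>t. - (t ^ (2 * n - 11)) * quintic n t)" by (simp add: f5_eq fun_eq_iff)
  with DERIV_mult[OF 1 quintic_deriv]
  have "(f5 n has_real_derivative - ((2 * real n - 11) * t ^ (2 * n - 12)) * quintic n t + quintic' n t * - (t ^ (2 * n - 11))) (at t)"
    by simp
  also have "- ((2 * real n - 11) * t ^ (2 * n - 12)) * quintic n t + quintic' n t * - (t ^ (2 * n - 11))
    = - (t ^ (2 * n - 12) / 3) * (3 * ((2 * real n - 11) * quintic n t + t * quintic' n t))"
    unfolding e by (simp add: algebra_simps)
  also have "\<dots> = - (t ^ (2 * n - 12)) * ((2 * real n - 11) / 3) * (3 * crit_cubic n t - t * crit_cubic' n t) * crit_cubic n t"
    unfolding quintic_ode by simp
  finally show ?thesis .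
qed

text \<open>The coefficient \<open>(2 n - 11) / 6\<close> is the one for which the derivative is a multiple of the square
  of the cubic.\<close>

definition majorant :: "nat \<Rightarrow> real \<Rightarrow> real" where
  "majorant n t = f5 n t + - (t ^ (2 * n - 11)) * ((2 * real n - 11) / 6 * (crit_cubic n t)\<^sup>2)"

lemma majorant_deriv:
  assumes "n \<ge> 6"
  shows "(majorant n has_real_derivative - (t ^ (2 * n - 12)) * ((2 * real n - 11) * (2 * real n - 5) / 6 * (crit_cubic n t)\<^sup>2)) (at t)"
proof -
  have e: "2 * n - 11 = Suc (2 * n - 12)" using assms by simp
  have r: "real (Suc (2 * n - 12)) = 2 * real n - 11" using assms by (simp add: of_nat_diff)
  have 1: "((\<lambda>t. - (t ^ (2 * n - 11))) has_real_derivative - ((2 * real n - 11) * t ^ (2 * n - 12))) (at t)"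
    using DERIV_minus[OF DERIV_pow[of "2 * n - 11" t]] e r by simp
  have 2: "((\<lambda>t. (2 * real n - 11) / 6 * (crit_cubic n t)\<^sup>2) has_real_derivative
      (2 * real n - 11) / 6 * (2 * crit_cubic n t * crit_cubic' n t)) (at t)"
    by (auto intro!: derivative_eq_intros crit_cubic_deriv)
  have 3: "t ^ (2 * n - 11) = t * t ^ (2 * n - 12)" unfolding e by simp
  define u where "u = t ^ (2 * n - 12)"
  show ?thesis
    unfolding majorant_def [abs_def]
    by (rule DERIV_cong[OF DERIV_add[OF f5_deriv[OF assms] DERIV_mult[OF 1 2]]])
       (unfold 3 u_def[symmetric], algebra)
qed

text \<open>The exponent \<open>2 * n - 11\<close> is odd, so the added term is nonnegative for
  nonpositive \<open>t\<close>.\<close>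

lemma f5_le_majorant:
  assumes "n \<ge> 6" "t \<le> 0"
  shows "f5 n t \<le> majorant n t"
proof -
  have "odd (2 * n - 11)" "0 < 2 * n - 11" using assms by presburger+
  then have "t ^ (2 * n - 11) \<le> 0" using assms(2) by (simp add: power_le_zero_eq)
  then show ?thesis using assms(1) by (simp add: majorant_def mult_nonpos_nonneg)
qed

text \<open>Sonin's comparison: the majorant is nonincreasing, and its added term vanishes at a root
  of the cubic.\<close>

lemma f5_le_at_critical_right:
  assumes n: "n \<ge> 6" and "t\<^sub>1 \<le> t" "t \<le> 0" and root: "crit_cubic n t\<^sub>1 = 0"
  shows "f5 n t \<le> f5 n t\<^sub>1"
proof -
  have ev: "even (2 * n - 12)" by presburger
  have "f5 n t \<le> majorant n t" by (rule f5_le_majorant[OF n]) fact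
  also have "\<dots> \<le> majorant n t\<^sub>1"
  proof (rule DERIV_nonpos_imp_nonincreasing[OF \<open>t\<^sub>1 \<le> t\<close>])
    fix x
    have "- (x ^ (2 * n - 12)) * ((2 * real n - 11) * (2 * real n - 5) / 6 * (crit_cubic n x)\<^sup>2) \<le> 0"
      using n zero_le_even_power[OF ev, of x] by (intro mult_nonpos_nonneg) auto
    then show "\<exists>y. (majorant n has_real_derivative y) (at x) \<and> y \<le> 0"
      using majorant_deriv[OF n] by blast
  qed
  also have "\<dots> = f5 n t\<^sub>1" by (simp add: majorant_def root)
  finally show ?thesis .
qed

text \<open>For the cubic q, the expression 3 q - x q' is \<open>L\<close> times a sum over the
  roots, each term being minus the root times the differences to the other two. All roots are
  negative, so to the left of them this is nonnegative while q is nonpositive, and \<open>f5\<close>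
  increases.\<close>

lemma f5_le_at_critical_left:
  assumes n: "n \<ge> 6" and "t \<le> t\<^sub>1" and ord: "t\<^sub>1 \<le> t\<^sub>2" "t\<^sub>1 \<le> t\<^sub>3" "t\<^sub>2 < 0" "t\<^sub>3 < 0"
    and L: "L > 0" and fact: "\<And>x. crit_cubic n x = L * (x - t\<^sub>1) * (x - t\<^sub>2) * (x - t\<^sub>3)"
  shows "f5 n t \<le> f5 n t\<^sub>1"
proof (rule DERIV_nonneg_imp_nondecreasing[OF \<open>t \<le> t\<^sub>1\<close>])
  fix x assume x: "t \<le> x" "x \<le> t\<^sub>1"
  have ev: "even (2 * n - 12)" by presburger
  have "((\<lambda>x. L * (x - t\<^sub>1) * (x - t\<^sub>2) * (x - t\<^sub>3)) has_real_derivative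
      L * ((x - t\<^sub>2) * (x - t\<^sub>3) + (x - t\<^sub>1) * (x - t\<^sub>3) + (x - t\<^sub>1) * (x - t\<^sub>2))) (at x)"
    by (auto intro!: derivative_eq_intros simp: algebra_simps)
  moreover have "crit_cubic n = (\<lambda>x. L * (x - t\<^sub>1) * (x - t\<^sub>2) * (x - t\<^sub>3))" using fact by auto
  ultimately have d: "crit_cubic' n x = L * ((x - t\<^sub>2) * (x - t\<^sub>3) + (x - t\<^sub>1) * (x - t\<^sub>3) + (x - t\<^sub>1) * (x - t\<^sub>2))"
    using crit_cubic_deriv[of n x] by (metis DERIV_unique)
  have "3 * crit_cubic n x - x * crit_cubic' n x
      = L * (- t\<^sub>1 * ((x - t\<^sub>2) * (x - t\<^sub>3)) + - t\<^sub>2 * ((x - t\<^sub>1) * (x - t\<^sub>3)) + - t\<^sub>3 * ((x - t\<^sub>1) * (x - t\<^sub>2)))"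
    unfolding fact d by algebra
  also have "\<dots> \<ge> 0"
    using x ord L by (intro mult_nonneg_nonneg add_nonneg_nonneg mult_nonpos_nonpos) auto
  finally have 1: "3 * crit_cubic n x - x * crit_cubic' n x \<ge> 0" .
  have 2: "crit_cubic n x \<le> 0"
  proof -
    have "(x - t\<^sub>2) * (x - t\<^sub>3) \<ge> 0" "L * (x - t\<^sub>1) \<le> 0"
      using x ord L by (auto intro: mult_nonpos_nonpos mult_nonneg_nonpos)
    then have "L * (x - t\<^sub>1) * ((x - t\<^sub>2) * (x - t\<^sub>3)) \<le> 0" by (rule mult_nonpos_nonneg[rotated])
    then show ?thesis unfolding fact by (simp add: mult.assoc)
  qed
  have "- (x ^ (2 * n - 12)) * ((2 * real n - 11) / 3) \<le> 0"
    using n zero_le_even_power[OF ev, of x] by (intro mult_nonpos_nonneg) auto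
  then have "- (x ^ (2 * n - 12)) * ((2 * real n - 11) / 3) * (3 * crit_cubic n x - x * crit_cubic' n x) \<le> 0"
    using 1 by (rule mult_nonpos_nonneg)
  then have "- (x ^ (2 * n - 12)) * ((2 * real n - 11) / 3) * (3 * crit_cubic n x - x * crit_cubic' n x) * crit_cubic n x \<ge> 0"
    using 2 by (rule mult_nonpos_nonpos)
  then show "\<exists>y. (f5 n has_real_derivative y) (at x) \<and> 0 \<le> y"
    using f5_deriv[OF n] by blast
qed

text \<open>Viete's trigonometric solution of a depressed cubic: as a shift by \<open>pi\<close>
  changes the sign of the cosine, the roots in \<open>y\<close> are \<open>r\<close> times the
  cosines of three angles whose triples equal \<open>\<psi>\<close> modulo
  \<open>2 * pi\<close>.\<close>

lemma prod_triple_angle: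
  fixes \<psi> r y :: real
  shows "(y + r * cos (\<psi> / 3 - pi / 3)) * (y + r * cos (\<psi> / 3 + pi / 3)) * (y - r * cos (\<psi> / 3))
    = y ^ 3 - 3 / 4 * r\<^sup>2 * y - r ^ 3 * cos \<psi> / 4"
proof -
  define c d where "c = cos (\<psi> / 3)" and "d = sin (\<psi> / 3)"
  have cd: "d\<^sup>2 = 1 - c\<^sup>2" by (simp add: c_def d_def sin_squared_eq)
  have t: "cos \<psi> = 4 * c ^ 3 - 3 * c"
    using cos_treble_cos[of "\<psi> / 3"] by (simp add: c_def)
  have 1: "cos (\<psi> / 3 - pi / 3) = c / 2 + d * sqrt 3 / 2" "cos (\<psi> / 3 + pi / 3) = c / 2 - d * sqrt 3 / 2"
    by (simp_all add: cos_diff cos_add c_def d_def cos_60 sin_60)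
  have "(y + r * (c / 2 + d * sqrt 3 / 2)) * (y + r * (c / 2 - d * sqrt 3 / 2)) = (y + r * c / 2)\<^sup>2 - r\<^sup>2 * d\<^sup>2 * (sqrt 3)\<^sup>2 / 4"
    by (simp add: power2_eq_square field_simps)
  also have "\<dots> = y\<^sup>2 + r * c * y + r\<^sup>2 * c\<^sup>2 - 3 / 4 * r\<^sup>2"
  proof -
    have 3: "(sqrt 3)\<^sup>2 = (3 :: real)" by simp
    have "(y + r * c / 2)\<^sup>2 - r\<^sup>2 * (1 - c\<^sup>2) * 3 / 4 = y\<^sup>2 + r * c * y + r\<^sup>2 * c\<^sup>2 - 3 / 4 * r\<^sup>2"
      by (simp add: power2_eq_square field_simps)
    then show ?thesis unfolding cd 3 .
  qed
  finally have *: "(y + r * (c / 2 + d * sqrt 3 / 2)) * (y + r * (c / 2 - d * sqrt 3 / 2))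
    = y\<^sup>2 + r * c * y + r\<^sup>2 * c\<^sup>2 - 3 / 4 * r\<^sup>2" .
  show ?thesis
    unfolding 1 t c_def[symmetric] * by algebra
qed

theorem f5_max:
  fixes n :: nat and \<phi> t\<^sub>1 :: real
  assumes n: "n \<ge> 6" and \<phi>: "\<phi> \<in> {pi / 4 <..< pi / 2}"
    and cos: "cos \<phi> = (2 * real n - 11) / (2 * real n - 5) * (sqrt (2 * real n - 3) / sqrt (5 * (real n - 3)))"
    and t1: "t\<^sub>1 = - (real n - 3) / (2 * (2 * real n - 1))
               - sqrt (5 * (real n - 3)) / ((2 * real n - 1) * sqrt (2 * real n - 3)) * cos (\<phi> / 3 - pi / 3)"
  shows "t\<^sub>1 \<in> {-1/4..0}" and "t \<in> {-1/4..0} \<Longrightarrow> f5 n t \<le> f5 n t\<^sub>1"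
proof -
  define N where "N = real n"
  have N: "N \<ge> 6" using n by (simp add: N_def)
  \<comment> \<open>\<open>c\<close> is the mean of the three roots, so the shift
    \<open>y = x - c\<close> removes the quadratic term; \<open>r\<close> is the amplitude fitted to
    the linear coefficient.\<close>
  define c r where "c = - (N - 3) / (2 * (2 * N - 1))"
    and "r = sqrt (5 * (N - 3)) / ((2 * N - 1) * sqrt (2 * N - 3))"
  define t2 t3 where "t2 = c - r * cos (\<phi> / 3 + pi / 3)" and "t3 = c + r * cos (\<phi> / 3)"
  have t1': "t\<^sub>1 = c - r * cos (\<phi> / 3 - pi / 3)" by (simp add: t1 c_def r_def N_def)
  have "r > 0" using N by (simp add: r_def)
  have r2: "r\<^sup>2 = 5 * (N - 3) / ((2 * N - 1)\<^sup>2 * (2 * N - 3))"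
    using N by (simp add: r_def power_divide power_mult_distrib)
  have rcos: "r * cos \<phi> = (2 * N - 11) / ((2 * N - 5) * (2 * N - 1))"
  proof -
    have "A / (u * B) * (v / w * (B / A)) = v / (w * u)" if "A \<noteq> 0" "B \<noteq> 0" for A B u v w :: real
      using that by simp
    then show ?thesis unfolding cos N_def[symmetric] r_def using N by simp
  qed
  \<comment> \<open>The leading coefficient of \<open>crit_cubic N\<close>.\<close>
  define L where "L = 8 * (2 * N - 1) * (2 * N - 3) * (2 * N - 5)"
  have "L > 0" using N by (simp add: L_def)
  have fact: "crit_cubic n x = L * (x - t\<^sub>1) * (x - t2) * (x - t3)" for x
  proof -
    have nz: "2 * N - 1 \<noteq> 0" "2 * N - 3 \<noteq> 0" "2 * N - 5 \<noteq> 0" using N by auto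
    define y where "y = x - c"
    have "L * (x - t\<^sub>1) * (x - t2) * (x - t3) = L * ((y + r * cos (\<phi> / 3 - pi / 3)) * (y + r * cos (\<phi> / 3 + pi / 3)) * (y - r * cos (\<phi> / 3)))"
      by (simp add: t1' t2_def t3_def y_def algebra_simps)
    also have "\<dots> = L * (y ^ 3 - 3 / 4 * r\<^sup>2 * y - r\<^sup>2 * (r * cos \<phi>) / 4)"
      unfolding prod_triple_angle by (simp add: power2_eq_square power3_eq_cube)
    also have "\<dots> = crit_cubic N x"
    proof -
      \<comment> \<open>With \<open>z = u * y\<close> the factors \<open>u\<close> in the
        denominators cancel. Only \<open>r\<^sup>2\<close> and \<open>r * cos \<phi>\<close> enter,
        through \<open>A\<close> and \<open>B\<close>, and both are rational in
        \<open>N\<close>.\<close>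
      define u where "u = 2 * N - 1"
      have Nu: "N = (u + 1) / 2" by (simp add: u_def)
      define z where "z = u * y"
      have u: "u \<noteq> 0" "u - 2 \<noteq> 0" "u - 4 \<noteq> 0" using nz by (simp_all add: u_def)
      have z: "z = u * x + (u - 5) / 4" using u by (simp add: z_def y_def c_def Nu field_simps)
      have A: "r\<^sup>2 * (u\<^sup>2 * (u - 2)) = 5 * (u - 5) / 2"
        unfolding r2 u_def using nz by (simp add: field_simps)
      have B: "r * cos \<phi> * ((u - 4) * u) = u - 10"
      proof -
        have e: "u - 4 = 2 * N - 5" "u - 10 = 2 * N - 11" by (simp_all add: u_def)
        have *: "p / q * q = p" if "q \<noteq> 0" for p q :: real using that by simp
        show ?thesis unfolding rcos e unfolding u_def by (rule *) (use nz in simp)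
      qed
      have L': "L = 8 * u * (u - 2) * (u - 4)" by (simp add: L_def u_def algebra_simps)
      have "L * (y ^ 3 - 3 / 4 * r\<^sup>2 * y - r\<^sup>2 * (r * cos \<phi>) / 4) * u\<^sup>2
          = 8 * (u - 2) * (u - 4) * (u * y) ^ 3 - 6 * (u - 4) * (r\<^sup>2 * (u\<^sup>2 * (u - 2))) * (u * y)
            - 2 * (r\<^sup>2 * (u\<^sup>2 * (u - 2))) * (r * cos \<phi> * ((u - 4) * u))"
        unfolding L' by algebra
      also have "\<dots> = 8 * ((u - 2) * (u - 4) * z ^ 3 - 15 / 8 * (u - 5) * (u - 4) * z - 5 / 8 * (u - 5) * (u - 10))"
        unfolding A B z_def by algebra
      also have "\<dots> = crit_cubic N x * u\<^sup>2"
        unfolding z crit_cubic_def Nu by (simp add: field_simps power2_eq_square power3_eq_cube)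
      finally show ?thesis using u by simp
    qed
    finally show ?thesis by (simp add: N_def)
  qed
  have ang: "pi / 12 < \<phi> / 3" "\<phi> / 3 < pi / 6" using \<phi> by auto
  have C2: "cos (\<phi> / 3 + pi / 3) > 0" using ang by (intro cos_gt_zero) auto
  have C1: "cos (\<phi> / 3 + pi / 3) \<le> cos (\<phi> / 3 - pi / 3)"
  proof -
    have "cos (\<phi> / 3 + pi / 3) \<le> cos (pi / 3 - \<phi> / 3)"
      using ang by (intro cos_monotone_0_pi_le) auto
    also have "\<dots> = cos (\<phi> / 3 - pi / 3)" by (metis cos_minus minus_diff_eq)
    finally show ?thesis .
  qed
  have C3: "cos (\<phi> / 3) > 0" using ang by (intro cos_gt_zero) auto
  have "c < 0" using N by (simp add: c_def field_simps)
  \<comment> \<open>This makes \<open>t3\<close>, the only root above \<open>c\<close>, negative.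
    The hypothesis on \<open>n\<close> enters through \<open>20 < 27\<close>, the value 27 being
    \<open>(N - 3) * (2 * N - 3)\<close> at \<open>N = 6\<close>.\<close>
  have "r < - c"
  proof (rule power2_less_imp_less)
    have "20 * (N - 3) < (N - 3)\<^sup>2 * (2 * N - 3)"
    proof -
      have "20 < 3 * (9::real)" by simp
      also have "\<dots> \<le> (N - 3) * (2 * N - 3)" using N by (intro mult_mono) auto
      finally have "20 * (N - 3) < (N - 3) * (2 * N - 3) * (N - 3)" using N by (intro mult_strict_right_mono) auto
      then show ?thesis by (simp add: power2_eq_square mult_ac)
    qed
    then have "5 * (N - 3) / (2 * N - 3) < (N - 3)\<^sup>2 / 4" using N by (simp add: field_simps)
    then have "5 * (N - 3) / (2 * N - 3) / (2 * N - 1)\<^sup>2 < (N - 3)\<^sup>2 / 4 / (2 * N - 1)\<^sup>2"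
      using N by (intro divide_strict_right_mono) auto
    moreover have "- c = (N - 3) / (2 * (2 * N - 1))" by (simp add: c_def minus_divide_left)
    then have "(- c)\<^sup>2 = (N - 3)\<^sup>2 / 4 / (2 * N - 1)\<^sup>2" by (simp only: power_divide power_mult_distrib) simp
    moreover have "r\<^sup>2 = 5 * (N - 3) / (2 * N - 3) / (2 * N - 1)\<^sup>2" by (simp add: r2 mult.commute)
    ultimately show "r\<^sup>2 < (- c)\<^sup>2" by (simp only:)
    show "0 \<le> - c" using \<open>c < 0\<close> by simp
  qed
  have ord: "t\<^sub>1 \<le> t2" "t\<^sub>1 \<le> t3" "t2 < 0" "t3 < 0"
  proof -
    show "t\<^sub>1 \<le> t2" using C1 \<open>r > 0\<close> by (simp add: t1' t2_def)
    have "0 \<le> r * cos (\<phi> / 3 - pi / 3)" "0 \<le> r * cos (\<phi> / 3)" "0 \<le> r * cos (\<phi> / 3 + pi / 3)"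
      using C1 C2 C3 \<open>r > 0\<close> by auto
    then show "t\<^sub>1 \<le> t3" "t2 < 0" using \<open>c < 0\<close> by (auto simp: t1' t2_def t3_def)
    have "r * cos (\<phi> / 3) \<le> r * 1" using \<open>r > 0\<close> by (intro mult_left_mono) auto
    then show "t3 < 0" using \<open>r < - c\<close> by (simp add: t3_def)
  qed
  have root: "crit_cubic n t\<^sub>1 = 0" by (simp add: fact)
  \<comment> \<open>Left of \<open>-1/4\<close> all four summands of the cubic are nonpositive and
    the last is negative, so no root lies there.\<close>
  have "t\<^sub>1 \<ge> -1/4"
  proof (rule ccontr)
    assume "\<not> t\<^sub>1 \<ge> -1/4"
    then have S: "1 + 4 * t\<^sub>1 < 0" "t\<^sub>1 < 0" by auto
    have "(N - 3) * (N - 4) * (N - 5) * (1 + 4 * t\<^sub>1) ^ 3 \<le> 0"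
      using N S by (intro mult_nonneg_nonpos) (auto simp: power_le_zero_eq)
    moreover have "30 * (N - 3) * (N - 4) * (1 + 4 * t\<^sub>1)\<^sup>2 * t\<^sub>1 \<le> 0"
      using N S by (intro mult_nonneg_nonpos) auto
    moreover have "180 * (N - 3) * (1 + 4 * t\<^sub>1) * t\<^sub>1\<^sup>2 \<le> 0"
      using N S by (intro mult_nonpos_nonneg mult_nonneg_nonpos) auto
    moreover have "120 * t\<^sub>1 ^ 3 < 0" using S by simp
    ultimately have "crit_cubic N t\<^sub>1 < 0" unfolding crit_cubic_def by linarith
    then show False using root by (simp add: N_def)
  qed
  then show "t\<^sub>1 \<in> {-1/4..0}" using ord by auto
  show "f5 n t \<le> f5 n t\<^sub>1" if "t \<in> {-1/4..0}"
  proof (cases "t \<le> t\<^sub>1")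
    case True
    show ?thesis by (rule f5_le_at_critical_left[OF n True ord \<open>L > 0\<close> fact])
  next
    case False
    then show ?thesis using that by (intro f5_le_at_critical_right[OF n _ _ root]) auto
  qed
qed

section \<open>The sharp constant for \<open>k = 5\<close>\<close>

theorem mainTheorem9:
  fixes n :: nat and \<phi> t\<^sub>1 :: real
  assumes "n \<ge> 6"
    and "\<phi> \<in> {pi / 4 <..< pi / 2}"
    and "cos \<phi> = (2 * real n - 11) / (2 * real n - 5)
                   * (sqrt (2 * real n - 3) / sqrt (5 * (real n - 3)))"
    and "t\<^sub>1 = - (real n - 3) / (2 * (2 * real n - 1))
               - sqrt (5 * (real n - 3)) / ((2 * real n - 1) * sqrt (2 * real n - 3))
                 * cos (\<phi> / 3 - pi / 3)"
  shows "(\<Lambda> n 5)\<^sup>2 = ereal (f5 n t\<^sub>1 / ((fact (n - 3))\<^sup>2 * (2 * real n - 11)))"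
proof -
  define D where "D = (fact (n - 3))\<^sup>2 * (2 * real n - 11)"
  have "D > 0" using assms(1) by (simp add: D_def)
  \<comment> \<open>The exponent \<open>n - 5 - 1\<close> of the truncated power that belongs to the
    derivative of order 5.\<close>
  define m where "m = n - 6"
  have n: "n = m + 6" "Suc m + 5 = n" "n - Suc m = 5" "n - 3 = m + 3" using assms(1) by (simp_all add: m_def)
  have D: "D = (fact (m + 3))\<^sup>2 * (2 * real m + 1)" unfolding D_def n(4) by (simp add: n(1))
  have A5: "A n 5 a = ereal (sqrt (f5 n (a\<^sup>2 - a) / D)) \<and> 0 \<le> f5 n (a\<^sup>2 - a) / D" if a: "0 \<le> a" "a \<le> 1" for a
  proof -
    from best_approx_exists[OF a, of m 5] obtain p where p: "best_approx n m a p (f5 n (a\<^sup>2 - a) / D)"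
      unfolding best_approx_error_eq_f5 n(2) unfolding n(1)[symmetric] D[symmetric] ..
    have "0 \<le> f5 n (a\<^sup>2 - a) / D"
      using p unfolding best_approx_def by (meson has_integral_nonneg zero_le_power2)
    moreover have "A n (n - Suc m) a = ereal (sqrt (f5 n (a\<^sup>2 - a) / D))"
      by (rule A_eq_sqrt[OF _ a p]) (simp add: n(1))
    ultimately show ?thesis by (simp only: n(3) simp_thms)
  qed
  have t1: "t\<^sub>1 \<in> {-1/4..0}" by (rule f5_max(1)[OF assms])
  \<comment> \<open>\<open>a\<close> is the smaller solution of
    \<open>a\<^sup>2 - a = t\<^sub>1\<close>; the range of \<open>t\<^sub>1\<close> makes it real
    and places it in the unit interval.\<close>
  define r where "r = sqrt (1 + 4 * t\<^sub>1)"
  define a where "a = (1 - r) / 2"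
  have "0 \<le> r" "r \<le> 1" using t1 by (simp_all add: r_def)
  then have a: "0 \<le> a" "a \<le> 1" by (simp_all add: a_def)
  have "r\<^sup>2 = 1 + 4 * t\<^sub>1" using t1 by (simp add: r_def)
  then have at: "a\<^sup>2 - a = t\<^sub>1" by (simp add: a_def power2_eq_square field_simps)
  have "\<Lambda> n 5 = ereal (sqrt (f5 n t\<^sub>1 / D))"
    unfolding \<Lambda>_def
  proof (rule antisym)
    show "(SUP a\<in>{0..1}. A n 5 a) \<le> ereal (sqrt (f5 n t\<^sub>1 / D))"
    proof (rule SUP_least)
      fix b :: real assume b: "b \<in> {0..1}"
      have "b\<^sup>2 - b \<in> {-1/4..0}"
      proof -
        have "b * b \<le> b * 1" using b by (intro mult_left_mono) auto
        moreover have "0 \<le> (b - 1/2)\<^sup>2" by simp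
        ultimately show ?thesis by (simp add: power2_eq_square algebra_simps)
      qed
      then have "f5 n (b\<^sup>2 - b) \<le> f5 n t\<^sub>1" by (rule f5_max(2)[OF assms])
      then have "sqrt (f5 n (b\<^sup>2 - b) / D) \<le> sqrt (f5 n t\<^sub>1 / D)"
        using \<open>D > 0\<close> by (intro real_sqrt_le_mono divide_right_mono) auto
      then show "A n 5 b \<le> ereal (sqrt (f5 n t\<^sub>1 / D))" using A5[of b] b by simp
    qed
    show "ereal (sqrt (f5 n t\<^sub>1 / D)) \<le> (SUP a\<in>{0..1}. A n 5 a)"
      using A5[OF a] a by (intro SUP_upper2[of a]) (auto simp: at)
  qed
  \<comment> \<open>The quotient is nonnegative because it is the squared approximation error at
    \<open>a\<close>, so squaring undoes the root.\<close>
  moreover have "(sqrt (f5 n t\<^sub>1 / D))\<^sup>2 = f5 n t\<^sub>1 / D" using A5[OF a] by (simp add: at)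
  ultimately show ?thesis unfolding D_def by (simp add: power2_eq_square)
qed

end
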